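(* Let $d\in\mathbb{N}$ with $d\ge 2$ and let $k\in\mathbb{N}$. In the max-choice preferential attachment tree model with parameter $d$, there exist random variables $N_l$ and $K_l$, $1\le l\le k$, that are finite almost surely, so that at any time $n\ge N_l$, $$\deg v_{K_l}(n)=M_l(n)$$ and $$M_1(n)>M_2(n)>\dots>M_l(n)>\deg v_i(n)\quad\text{for any } i\ne K_1,\dots,K_l.$$
   Context: Max-choice preferential attachment tree model with parameter $d$: let $V=\{v_i : i\in\mathbb{N}\}$ be a countable non-random set of vertices. Random trees $P_n$, $n\in\mathbb{N}$, are defined inductively. $P_1$ is the one-edge tree on the vertices $v_1,v_2$. Given $P_n$ (whose vertex set is $V(P_n)=\{v_1,\dots,v_{n+1}\}$), add the vertex $v_{n+2}$ and one edge as follows. Let $\mathcal{F}_n=\sigma\{\mathcal{E}_1,\dots,\mathcal{E}_n\}$, where $\mathcal{E}_m$ is the edge set of $P_m$. Conditionally on $\mathcal{F}_n$, let $X_n^1,\dots,X_n^d$ be i.i.d. vertices of $V(P_n)$ with $\mathbb{P}[X_n^1=v_i\mid\mathcal{F}_n]=\frac{\deg v_i(n)}{2n}$, where $\deg v_i(n)$ is the degree of $v_i$ in $P_n$ (so $\sum_i\deg v_i(n)=2n$). Let $Y_n$ be whichever of $X_n^1,\dots,X_n^d$ has the largest degree in $P_n$; in the case of a tie, choose according to an independent fair coin toss. $P_{n+1}$ is obtained from $P_n$ by adding $v_{n+2}$ and the edge between $v_{n+2}$ and $Y_n$. For fixed $k\in\mathbb{N}$, $M_1(n)\ge M_2(n)\ge\dots\ge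 M_k(n)$ denote the degrees of the $k$ highest degree vertices of $P_n$ (listed with multiplicity); if $P_n$ has fewer than $l$ vertices, put $M_l(n)=1$. The indices $i$ range over the vertices $v_i$ of $P_n$, and $K_l$ takes values in the index set $\mathbb{N}$ of the vertices. *)

theory Defs
  imports "HOL-Probability.Probability"
begin

text \<open>
  The vertex \<open>v\<^sub>i\<close> is represented by its index \<open>i \<ge> 1\<close>, an undirected edge by the two-element set of
  its endpoints, and the tree \<open>P\<^sub>n\<close> (\<open>n \<ge> 1\<close>) by its edge set; its vertex set is \<open>{1..n + 1}\<close>.
\<close>

definition tree_vertices :: "nat \<Rightarrow> nat set" where
  "tree_vertices n = {1..n + 1}"

definition degree_in :: "nat set set \<Rightarrow> nat \<Rightarrow> nat" where
  "degree_in E v = card {e \<in> E. v \<in> e}"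

text \<open>
  Edge set of \<open>P\<^sub>n\<close> when, for every \<open>m \<ge> 1\<close>, the vertex \<open>v\<^sub>m\<^sub>+\<^sub>2\<close> added at step \<open>m\<close> is attached to the
  vertex \<open>y m\<close>. The value at \<open>0\<close> is a dummy.
\<close>

fun tree_edges :: "(nat \<Rightarrow> nat) \<Rightarrow> nat \<Rightarrow> nat set set" where
  "tree_edges y 0 = {}"
| "tree_edges y (Suc 0) = {{1, 2}}"
| "tree_edges y (Suc (Suc n)) = insert {n + 3, y (Suc n)} (tree_edges y (Suc n))"

abbreviation deg :: "(nat \<Rightarrow> nat) \<Rightarrow> nat \<Rightarrow> nat \<Rightarrow> nat" where
  "deg y n v \<equiv> degree_in (tree_edges y n) v"

text \<open>The degree \<open>M\<^sub>l(n)\<close> of the \<open>l\<close>-th highest degree vertex (\<open>l \<ge> 1\<close>), with multiplicity.\<close>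

definition ranked_degree :: "(nat \<Rightarrow> nat) \<Rightarrow> nat \<Rightarrow> nat \<Rightarrow> nat" where
  "ranked_degree y n l =
     (if l \<le> card (tree_vertices n)
      then rev (sort (map (deg y n) (sorted_list_of_set (tree_vertices n)))) ! (l - 1)
      else 1)"

definition max_degree_choices :: "nat \<Rightarrow> (nat \<Rightarrow> nat) \<Rightarrow> nat \<Rightarrow> (nat \<Rightarrow> nat) \<Rightarrow> nat set" where
  "max_degree_choices d y n x =
     {v \<in> x ` {1..d}. \<forall>w \<in> x ` {1..d}. deg y n w \<le> deg y n v}"

definition preimages :: "'a measure \<Rightarrow> ('a \<Rightarrow> 'b) \<Rightarrow> 'a set set" where
  "preimages M Z = {Z -` A \<inter> space M | A. True}"

definition edge_history :: "'a measure \<Rightarrow> (nat \<Rightarrow> 'a \<Rightarrow> nat) \<Rightarrow> nat \<Rightarrow> 'a measure" where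
  "edge_history M Y n =
     sigma (space M) (\<Union>m \<in> {1..n}. preimages M (\<lambda>\<omega>. tree_edges (\<lambda>i. Y i \<omega>) m))"

definition edge_choice_history ::
  "'a measure \<Rightarrow> nat \<Rightarrow> (nat \<Rightarrow> nat \<Rightarrow> 'a \<Rightarrow> nat) \<Rightarrow> (nat \<Rightarrow> 'a \<Rightarrow> nat) \<Rightarrow> nat \<Rightarrow> 'a measure" where
  "edge_choice_history M d X Y n =
     sigma (space M) ((\<Union>m \<in> {1..n}. preimages M (\<lambda>\<omega>. tree_edges (\<lambda>i. Y i \<omega>) m)) \<union>
                      (\<Union>j \<in> {1..d}. preimages M (X n j)))"

text \<open>
  \<open>X n j\<close> is the \<open>j\<close>-th sampled vertex \<open>X\<^sub>n\<^sup>j\<close> and \<open>Y n\<close> the vertex \<open>Y\<^sub>n\<close> selected among them; only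
  indices \<open>n \<ge> 1\<close> and \<open>1 \<le> j \<le> d\<close> are constrained. The product form of the joint conditional law in
  \<open>X_law\<close> says that the samples are conditionally i.i.d. given \<open>\<F>\<^sub>n = edge_history M Y n\<close>. Ties are
  broken uniformly among the distinct tied vertices, independently of \<open>\<F>\<^sub>n\<close> and of the samples; this
  is expressed in \<open>Y_law\<close> by the conditional law of \<open>Y\<^sub>n\<close> given both.
\<close>

locale max_choice_tree = prob_space M
  for M :: "'a measure" +
  fixes d :: nat
    and X :: "nat \<Rightarrow> nat \<Rightarrow> 'a \<Rightarrow> nat"
    and Y :: "nat \<Rightarrow> 'a \<Rightarrow> nat"
  assumes X_measurable:
      "\<And>n j. n \<ge> 1 \<Longrightarrow> j \<in> {1..d} \<Longrightarrow> X n j \<in> measurable M (count_space UNIV)"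
    and Y_measurable:
      "\<And>n. n \<ge> 1 \<Longrightarrow> Y n \<in> measurable M (count_space UNIV)"
    and X_vertex:
      "\<And>n j \<omega>. n \<ge> 1 \<Longrightarrow> j \<in> {1..d} \<Longrightarrow> \<omega> \<in> space M \<Longrightarrow> X n j \<omega> \<in> tree_vertices n"
    and Y_choice:
      "\<And>n \<omega>. n \<ge> 1 \<Longrightarrow> \<omega> \<in> space M \<Longrightarrow>
         Y n \<omega> \<in> max_degree_choices d (\<lambda>i. Y i \<omega>) n (\<lambda>j. X n j \<omega>)"
    and X_law:
      "\<And>n x. n \<ge> 1 \<Longrightarrow> (\<forall>j \<in> {1..d}. x j \<in> tree_vertices n) \<Longrightarrow>
         AE \<omega> in M.
           real_cond_exp M (edge_history M Y n)
             (indicator {\<omega> \<in> space M. \<forall>j \<in> {1..d}. X n j \<omega> = x j}) \<omega>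
           = (\<Prod>j = 1..d. real (deg (\<lambda>i. Y i \<omega>) n (x j)) / (2 * real n))"
    and Y_law:
      "\<And>n v. n \<ge> 1 \<Longrightarrow> v \<in> tree_vertices n \<Longrightarrow>
         AE \<omega> in M.
           real_cond_exp M (edge_choice_history M d X Y n)
             (indicator {\<omega> \<in> space M. Y n \<omega> = v}) \<omega>
           = (let T = max_degree_choices d (\<lambda>i. Y i \<omega>) n (\<lambda>j. X n j \<omega>)
              in indicator T v / real (card T))"

end

theory Submission
  imports Defs
begin

text \<open>
  Given \<open>P\<^sub>n\<close>, the vertex \<open>v\<close> is selected with probability \<open>deg v / (2n) * R(deg v)\<close>, where \<open>R\<close> is
  nondecreasing. Hence the pair of degrees \<open>(a, b)\<close> of two vertices favours the larger one at least
  as much as a Polya urn does, and \<open>(a + b - 1)! / ((a - 1)! (b - 1)!) / 2^(a + b)\<close> is a supermartingale.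
  It is at least \<open>\<surd>a / 4\<close> at a tie \<open>(a, a)\<close> and equals \<open>m / 2^(m + 1)\<close> at \<open>(m, 1)\<close>. By the maximal
  inequality, two given vertices almost surely have no ties at arbitrarily high degrees, and a new
  vertex ever meets a vertex of degree \<open>m\<close> with probability at most \<open>2m / 2^m\<close>.

  The degrees of any \<open>k\<close> vertices sum to at most \<open>n + k\<close>, so the vertices of degree at most \<open>M\<^sub>k(n)\<close>
  keep a quarter of the mass. It follows that \<open>n\<^sup>c (1 / M\<^sub>1(n) + \<dots> + 1 / M\<^sub>k(n))\<close> is a supermartingale
  for \<open>c = 4\<^sup>-\<^sup>d\<close>, so the top \<open>k\<close> degrees grow polynomially. By Borel-Cantelli only finitely many
  vertices ever enter the top \<open>k\<close>; eventually there are no ties involving the top \<open>k\<close>, and since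
  degrees grow by unit steps their order is frozen from then on.
\<close>

section \<open>Selection probabilities\<close>

text \<open>What survives is an inequality between the two selection probabilities, hence one-sided
  supermartingale estimates throughout. The growth estimate needs a vertex with few heavier ones, so
  it concerns the changing set of the top \<open>k\<close> vertices. Writing the sum of reciprocals
  as a minimum over \<open>k\<close>-sets absorbs these changes, since keeping the previous set
  gives an upper bound. The exponent \<open>c\<close> collects a fourth for each of the
  \<open>d - 1\<close> other samples, which must not exceed the vertex, and a last fourth from the
  \<open>2n\<close> in the sampling law and from \<open>g + 1 \<le> 2 * g\<close> in the decrement
  of \<open>1 / g\<close>. A tiny exponent is enough, because an exponentially small meeting
  probability beats every power of the degree; a power \<open>q > 2 / c\<close> makes the bounds
  summable. Trees are tracked through finitely many states, so conditional expectations enter only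
  in the one-step law.\<close>

definition largest :: "nat \<Rightarrow> (nat \<Rightarrow> nat) \<Rightarrow> (nat \<Rightarrow> nat) \<Rightarrow> nat set" where
  "largest d g x = {v \<in> x ` {1..d}. \<forall>w \<in> x ` {1..d}. g w \<le> g v}"

text \<open>The law of the selected vertex for a frozen weight function \<open>g\<close>, where
  \<open>x\<close> is the tuple of the \<open>d\<close> samples. Taking extensional tuples makes the
  sum finite and counts every outcome of the samples once.\<close>

definition choice_prob :: "nat \<Rightarrow> nat set \<Rightarrow> (nat \<Rightarrow> nat) \<Rightarrow> nat \<Rightarrow> real" where
  "choice_prob d V g v = (\<Sum>x \<in> {1..d} \<rightarrow>\<^sub>E V.
     indicator (largest d g x) v / real (card (largest d g x)) *
     (\<Prod>j = 1..d. real (g (x j)) / real (sum g V)))"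

definition mass :: "nat set \<Rightarrow> (nat \<Rightarrow> nat) \<Rightarrow> (nat \<Rightarrow> bool) \<Rightarrow> real" where
  "mass V g P = (\<Sum>w | w \<in> V \<and> P (g w). real (g w) / real (sum g V))"

text \<open>The factor \<open>R\<close> of the overview. It is the quotient (x^d - y^d) / (x - y),
  for the masses x of weights at most \<open>a\<close> and y of weights below \<open>a\<close>,
  written as a polynomial so that monotonicity in \<open>a\<close> is visible.\<close>

definition advantage :: "nat \<Rightarrow> nat set \<Rightarrow> (nat \<Rightarrow> nat) \<Rightarrow> nat \<Rightarrow> real" where
  "advantage d V g a =
     (\<Sum>i<d. mass V g (\<lambda>b. b \<le> a) ^ i * mass V g (\<lambda>b. b < a) ^ (d - Suc i))"

lemma largest_nonempty: "d \<ge> 1 \<Longrightarrow> largest d g x \<noteq> {}"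
proof -
  assume d: "d \<ge> 1"
  let ?S = "x ` {1..d}"
  have "g ` ?S \<noteq> {}" "finite (g ` ?S)" using d by simp_all
  then have "Max (g ` ?S) \<in> g ` ?S" and mx: "\<And>w. w \<in> ?S \<Longrightarrow> g w \<le> Max (g ` ?S)" by auto
  then obtain v where "v \<in> ?S" "g v = Max (g ` ?S)" by (metis imageE)
  then have "v \<in> largest d g x" unfolding largest_def using mx by simp
  then show ?thesis by blast
qed

lemma largest_subset: "largest d g x \<subseteq> x ` {1..d}"
  by (auto simp: largest_def)

lemma finite_largest [simp]: "finite (largest d g x)"
  by (rule finite_subset[OF largest_subset]) auto

lemma largest_cong: "(\<And>j. j \<in> {1..d} \<Longrightarrow> x j = y j) \<Longrightarrow> largest d g x = largest d g y"
proof -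
  assume "\<And>j. j \<in> {1..d} \<Longrightarrow> x j = y j"
  then have "x ` {1..d} = y ` {1..d}" by (rule image_cong[OF refl])
  then show ?thesis by (simp add: largest_def)
qed

text \<open>Relabelling all samples by the transposition of \<open>v\<close> and \<open>v'\<close>
  is a bijection on tuples. It preserves the product weight because \<open>g\<close> is invariant,
  and it carries the tied set of a tuple to that of its image.\<close>

lemma choice_prob_swap:
  assumes "v \<in> V" "v' \<in> V" "g v = g v'"
  shows "choice_prob d V g v = choice_prob d V g v'"
proof -
  define \<sigma> where "\<sigma> = Transposition.transpose v v'"
  have \<sigma>V: "\<sigma> w \<in> V \<longleftrightarrow> w \<in> V" for w
    using assms by (auto simp: \<sigma>_def Transposition.transpose_def split: if_splits)
  have \<sigma>\<sigma>: "\<sigma> (\<sigma> w) = w" for w by (simp add: \<sigma>_def)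
  have g\<sigma>: "g (\<sigma> w) = g w" for w using assms by (auto simp: \<sigma>_def Transposition.transpose_def)
  define h where "h = (\<lambda>x. restrict (\<lambda>j. \<sigma> (x j)) {1..d})"
  have L: "largest d g (h x) = \<sigma> ` largest d g x" for x
  proof -
    have *: "h x ` {1..d} = \<sigma> ` x ` {1..d}" by (auto simp: h_def image_image)
    show ?thesis unfolding largest_def * by (auto simp: g\<sigma>)
  qed
  have inj: "inj \<sigma>" by (metis \<sigma>\<sigma> injI)
  have \<sigma>v: "\<sigma> v = v'" by (simp add: \<sigma>_def)
  show ?thesis
    unfolding choice_prob_def
  proof (rule sum.reindex_bij_witness[where i = h and j = h], goal_cases)
    case (1 x) then show ?case by (auto simp: h_def \<sigma>\<sigma> fun_eq_iff PiE_def extensional_def)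
  next
    case (2 x) then show ?case by (auto simp: h_def \<sigma>V PiE_def)
  next
    case (3 x) then show ?case by (auto simp: h_def \<sigma>\<sigma> fun_eq_iff PiE_def extensional_def)
  next
    case (4 x) then show ?case by (auto simp: h_def \<sigma>V PiE_def)
  next
    case (5 x)
    have "indicator (largest d g (h x)) v' = (indicator (largest d g x) v :: real)"
      unfolding L \<sigma>v[symmetric] using inj by (auto simp: indicator_def inj_image_mem_iff)
    moreover have "card (largest d g (h x)) = card (largest d g x)"
      unfolding L by (rule card_image) (use inj in \<open>auto simp: inj_on_def\<close>)
    moreover have "(\<Prod>j = 1..d. real (g (h x j)) / real (sum g V))
                 = (\<Prod>j = 1..d. real (g (x j)) / real (sum g V))"
      by (rule prod.cong) (auto simp: h_def g\<sigma>)
    ultimately show ?case by simp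
  qed
qed

text \<open>Independence of the samples: the sum of products factorises into \<open>d\<close> equal
  sums.\<close>

lemma sum_PiE_Collect_prod:
  fixes w :: "nat \<Rightarrow> real"
  assumes "finite V"
  shows "(\<Sum>x \<in> {1..d} \<rightarrow>\<^sub>E V. of_bool (\<forall>j\<in>{1..d}. P (x j)) * (\<Prod>j=1..d. w (x j)))
       = (\<Sum>v | v \<in> V \<and> P v. w v) ^ d"
proof -
  have "(\<Sum>x \<in> {1..d} \<rightarrow>\<^sub>E V. of_bool (\<forall>j\<in>{1..d}. P (x j)) * (\<Prod>j=1..d. w (x j)))
      = (\<Sum>x \<in> {1..d} \<rightarrow>\<^sub>E {v \<in> V. P v}. (\<Prod>j=1..d. w (x j)))"
    using assms by (intro sum.mono_neutral_cong_right) (auto intro!: finite_PiE simp: PiE_iff)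
  also have "\<dots> = (\<Prod>j=1..d. \<Sum>v | v \<in> V \<and> P v. w v)"
    using assms by (subst prod_sum_PiE) auto
  finally show ?thesis by simp
qed

text \<open>The tie-breaking shares of one tuple add up to 1 and all lie on the level of its
  maximum. The sum over the level \<open>a\<close> is therefore the probability that the maximum of
  \<open>d\<close> independent samples equals \<open>a\<close>.\<close>

lemma choice_prob_level_sum:
  assumes V: "finite V" and d: "d \<ge> 1"
  shows "(\<Sum>v | v \<in> V \<and> g v = a. choice_prob d V g v)
       = mass V g (\<lambda>b. b \<le> a) ^ d - mass V g (\<lambda>b. b < a) ^ d"
proof -
  let ?w = "\<lambda>v. real (g v) / real (sum g V)"
  let ?C = "{v \<in> V. g v = a}"
  have *: "(\<Sum>v\<in>?C. indicator (largest d g x) v / real (card (largest d g x)))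
         = of_bool (\<forall>j\<in>{1..d}. g (x j) \<le> a) - of_bool (\<forall>j\<in>{1..d}. g (x j) < a)"
    if x: "x \<in> {1..d} \<rightarrow>\<^sub>E V" for x
  proof -
    let ?L = "largest d g x"
    obtain m where m: "m \<in> ?L" using largest_nonempty[OF d] by blast
    then have lvl: "v \<in> ?L \<longleftrightarrow> v \<in> x ` {1..d} \<and> g v = g m" for v
      by (force simp: largest_def)
    have mx: "g (x j) \<le> g m" if "j \<in> {1..d}" for j using m that by (auto simp: largest_def)
    obtain j0 where j0: "j0 \<in> {1..d}" "m = x j0" using m by (auto simp: largest_def)
    have LV: "?L \<subseteq> V" using x by (auto simp: largest_def)
    have "(\<Sum>v\<in>?C. indicator ?L v / real (card ?L)) = real (card (?C \<inter> ?L)) / real (card ?L)"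
      using V by (simp only: sum_divide_distrib[symmetric]) (simp add: indicator_def sum.If_cases Int_def)
    also have "\<dots> = of_bool (g m = a)"
    proof (cases "g m = a")
      case True
      then have "?C \<inter> ?L = ?L" using LV lvl by auto
      moreover have "card ?L \<noteq> 0" using m by auto
      ultimately show ?thesis using True by simp
    next
      case False
      then have "?C \<inter> ?L = {}" using lvl by auto
      then show ?thesis using False by simp
    qed
    also have "\<dots> = of_bool (\<forall>j\<in>{1..d}. g (x j) \<le> a) - of_bool (\<forall>j\<in>{1..d}. g (x j) < a)"
    proof -
      have "(\<forall>j\<in>{1..d}. g (x j) \<le> a) \<longleftrightarrow> g m \<le> a"
        using mx j0 by (metis order_trans)
      moreover have "(\<forall>j\<in>{1..d}. g (x j) < a) \<longleftrightarrow> g m < a"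
        using mx j0 by (metis le_less_trans)
      ultimately show ?thesis by simp
    qed
    finally show ?thesis .
  qed
  have "(\<Sum>v\<in>?C. choice_prob d V g v)
      = (\<Sum>x \<in> {1..d} \<rightarrow>\<^sub>E V. (\<Sum>v\<in>?C. indicator (largest d g x) v / real (card (largest d g x)))
           * (\<Prod>j = 1..d. ?w (x j)))"
    unfolding choice_prob_def by (subst sum.swap) (simp add: sum_distrib_right)
  also have "\<dots> = (\<Sum>x \<in> {1..d} \<rightarrow>\<^sub>E V.
        of_bool (\<forall>j\<in>{1..d}. g (x j) \<le> a) * (\<Prod>j = 1..d. ?w (x j))
      - of_bool (\<forall>j\<in>{1..d}. g (x j) < a) * (\<Prod>j = 1..d. ?w (x j)))"
    by (rule sum.cong[OF refl]) (simp only: * left_diff_distrib)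
  also have "\<dots> = mass V g (\<lambda>b. b \<le> a) ^ d - mass V g (\<lambda>b. b < a) ^ d"
    unfolding sum_subtractf
    using sum_PiE_Collect_prod[OF V, where w = ?w and P = "\<lambda>v. g v \<le> a"]
      sum_PiE_Collect_prod[OF V, where w = ?w and P = "\<lambda>v. g v < a"]
    by (simp add: mass_def)
  finally show ?thesis .
qed

text \<open>By symmetry the probability of selecting some vertex of degree \<open>a\<close>, which is
  \<open>P(all degrees \<le> a) - P(all degrees < a)\<close>, is shared equally among these vertices; \<open>advantage\<close> is the
  factor left after dividing this difference of powers by the difference of the bases.\<close>

lemma choice_prob_eq:
  assumes V: "finite V" and d: "d \<ge> 1" and v: "v \<in> V"
  shows "choice_prob d V g v = real (g v) / real (sum g V) * advantage d V g (g v)"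
proof -
  let ?a = "g v" and ?C = "{u \<in> V. g u = g v}"
  let ?x = "mass V g (\<lambda>b. b \<le> g v)" and ?y = "mass V g (\<lambda>b. b < g v)"
  have c: "card ?C > 0" using V v by (auto simp: card_gt_0_iff)
  obtain n where n: "d = Suc n" using d by (cases d) auto
  have xy: "?x - ?y = real (card ?C) * (real ?a / real (sum g V))"
  proof -
    have "{w \<in> V. g w \<le> g v} = {w \<in> V. g w < g v} \<union> ?C" by auto
    then have "?x = ?y + (\<Sum>w\<in>?C. real (g w) / real (sum g V))"
      unfolding mass_def using V by (simp only:) (subst sum.union_disjoint, auto)
    then show ?thesis by simp
  qed
  have "real (card ?C) * choice_prob d V g v = (\<Sum>u\<in>?C. choice_prob d V g u)"
  proof -
    have "(\<Sum>u\<in>?C. choice_prob d V g u) = (\<Sum>u\<in>?C. choice_prob d V g v)"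
      by (intro sum.cong refl choice_prob_swap) (use v in auto)
    then show ?thesis by simp
  qed
  also have "\<dots> = ?x ^ d - ?y ^ d" by (rule choice_prob_level_sum[OF V d])
  also have "\<dots> = (?x - ?y) * advantage d V g ?a"
    unfolding n diff_power_eq_sum advantage_def by simp
  finally have "real (card ?C) * choice_prob d V g v
      = real (card ?C) * (real (g v) / real (sum g V) * advantage d V g (g v))"
    unfolding xy by (simp only: mult.assoc)
  then show ?thesis using c by (simp only: mult_cancel_left) simp
qed

lemma mass_nonneg: "mass V g P \<ge> 0"
  unfolding mass_def by (intro sum_nonneg divide_nonneg_nonneg) (auto intro: sum_nonneg)

lemma mass_mono:
  assumes "finite V" "\<And>b. P b \<Longrightarrow> Q b"
  shows "mass V g P \<le> mass V g Q"
  unfolding mass_def using assms by (intro sum_mono2 divide_nonneg_nonneg) (auto intro: sum_nonneg)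

lemma advantage_mono:
  assumes "finite V" "a \<le> b"
  shows "advantage d V g a \<le> advantage d V g b"
  unfolding advantage_def using assms
  by (intro sum_mono mult_mono power_mono mass_mono mass_nonneg zero_le_power) auto

text \<open>Only the summand \<open>i = d - 1\<close> is kept, in which the strict mass has exponent
  0. It is the probability that the other \<open>d - 1\<close> samples are no heavier than
  \<open>a\<close>.\<close>

lemma advantage_ge:
  assumes "d \<ge> 1"
  shows "mass V g (\<lambda>b. b \<le> a) ^ (d - 1) \<le> advantage d V g a"
proof -
  have "mass V g (\<lambda>b. b \<le> a) ^ (d - 1) * mass V g (\<lambda>b. b < a) ^ (d - Suc (d - 1))
      \<le> advantage d V g a"
    unfolding advantage_def using assms
    by (intro member_le_sum) (auto intro!: mult_nonneg_nonneg zero_le_power mass_nonneg)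
  then show ?thesis using assms by simp
qed

lemma sum_choice_prob:
  assumes V: "finite V" and d: "d \<ge> 1" and S: "sum g V > 0"
  shows "(\<Sum>v\<in>V. choice_prob d V g v) = 1"
proof -
  let ?w = "\<lambda>v. real (g v) / real (sum g V)"
  have *: "(\<Sum>v\<in>V. indicator (largest d g x) v / real (card (largest d g x))) = (1::real)"
    if x: "x \<in> {1..d} \<rightarrow>\<^sub>E V" for x
  proof -
    have "V \<inter> largest d g x = largest d g x" using x by (auto simp: largest_def)
    moreover have "card (largest d g x) \<noteq> 0" using largest_nonempty[OF d] by simp
    ultimately show ?thesis
      using V by (simp only: sum_divide_distrib[symmetric]) (simp add: indicator_def sum.If_cases Int_def)
  qed
  have "(\<Sum>v\<in>V. choice_prob d V g v)
      = (\<Sum>x \<in> {1..d} \<rightarrow>\<^sub>E V. (\<Sum>v\<in>V. indicator (largest d g x) v / real (card (largest d g x)))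
           * (\<Prod>j = 1..d. ?w (x j)))"
    unfolding choice_prob_def by (subst sum.swap) (simp add: sum_distrib_right)
  also have "\<dots> = (\<Sum>x \<in> {1..d} \<rightarrow>\<^sub>E V. \<Prod>j = 1..d. ?w (x j))"
    by (rule sum.cong[OF refl]) (simp only: * mult_1)
  also have "\<dots> = (\<Prod>j = 1..d. \<Sum>v\<in>V. ?w v)"
    using V by (subst prod_sum_PiE) auto
  also have "(\<Sum>v\<in>V. ?w v) = 1"
    using S by (simp only: sum_divide_distrib[symmetric] of_nat_sum[symmetric]) (simp del: of_nat_sum)
  finally show ?thesis by simp
qed

lemma choice_prob_nonneg: "choice_prob d V g v \<ge> 0"
  unfolding choice_prob_def by (intro sum_nonneg mult_nonneg_nonneg prod_nonneg ballI divide_nonneg_nonneg)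
    (auto intro: sum_nonneg)

section \<open>Degrees in the tree\<close>

text \<open>The trees reachable through some legal sequence of attachments, independent of the
  probability space. For each \<open>n\<close> there are finitely many, so every function of the
  tree is bounded and expectations reduce to finite sums.\<close>

definition tree_states :: "nat \<Rightarrow> nat set set set" where
  "tree_states n = {tree_edges y n | y. \<forall>m\<ge>1. y m \<in> tree_vertices m}"

lemma finite_tree_vertices [simp]: "finite (tree_vertices n)"
  by (simp add: tree_vertices_def)

lemma card_tree_vertices [simp]: "card (tree_vertices n) = n + 1"
  by (simp add: tree_vertices_def)

lemma tree_vertices_mono: "n \<le> m \<Longrightarrow> tree_vertices n \<subseteq> tree_vertices m"
  by (auto simp: tree_vertices_def)

lemma tree_vertices_Suc: "tree_vertices (Suc n) = insert (Suc (Suc n)) (tree_vertices n)"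
  by (auto simp: tree_vertices_def)

lemma tree_edges_Suc: "n \<ge> 1 \<Longrightarrow> tree_edges y (Suc n) = insert {Suc (Suc n), y n} (tree_edges y n)"
  by (cases n) auto

lemma tree_states_induct [consumes 2, case_names base step]:
  assumes "n \<ge> 1" "e \<in> tree_states n"
    and "P (Suc 0) {{Suc 0, 2}}"
    and "\<And>n e v. n \<ge> 1 \<Longrightarrow> e \<in> tree_states n \<Longrightarrow> v \<in> tree_vertices n \<Longrightarrow> P n e
           \<Longrightarrow> P (Suc n) (insert {Suc (Suc n), v} e)"
  shows "P n e"
proof -
  obtain y where y: "e = tree_edges y n" "\<forall>m\<ge>1. y m \<in> tree_vertices m"
    using assms(2) by (auto simp: tree_states_def)
  show ?thesis
    unfolding y(1) using assms(1)
  proof (induction n rule: dec_induct)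
    case base
    then show ?case using assms(3) by simp
  next
    case (step n)
    have "tree_edges y n \<in> tree_states n" using y(2) by (auto simp: tree_states_def)
    then show ?case using assms(4)[of n "tree_edges y n" "y n"] step y(2) by (simp add: tree_edges_Suc)
  qed
qed

lemma tree_states_subset: "n \<ge> 1 \<Longrightarrow> e \<in> tree_states n \<Longrightarrow> e \<subseteq> Pow (tree_vertices n)"
  by (induction rule: tree_states_induct) (fastforce simp: tree_vertices_def)+

lemma finite_tree_state: "n \<ge> 1 \<Longrightarrow> e \<in> tree_states n \<Longrightarrow> finite e"
  using tree_states_subset by (meson finite_Pow_iff finite_subset finite_tree_vertices)

lemma finite_tree_states: "n \<ge> 1 \<Longrightarrow> finite (tree_states n)"
  by (rule finite_subset[of _ "Pow (Pow (tree_vertices n))"]) (use tree_states_subset in auto)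

lemma degree_in_insert:
  assumes "n \<ge> 1" "e \<in> tree_states n" "v \<in> tree_vertices n"
  shows "degree_in (insert {Suc (Suc n), v} e) x = degree_in e x + of_bool (x = v) + of_bool (x = Suc (Suc n))"
proof -
  have new: "{Suc (Suc n), v} \<notin> e"
    using tree_states_subset[OF assms(1,2)] by (auto simp: tree_vertices_def)
  have v: "v \<noteq> Suc (Suc n)" using assms(3) by (auto simp: tree_vertices_def)
  have "finite e" using finite_tree_state assms by blast
  then show ?thesis
  proof (cases "x = v \<or> x = Suc (Suc n)")
    case True
    then have "{f \<in> insert {Suc (Suc n), v} e. x \<in> f} = insert {Suc (Suc n), v} {f \<in> e. x \<in> f}" by auto
    then show ?thesis using new v True \<open>finite e\<close> by (auto simp: degree_in_def)
  next
    case False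
    then have "{f \<in> insert {Suc (Suc n), v} e. x \<in> f} = {f \<in> e. x \<in> f}" by auto
    then show ?thesis using False by (simp add: degree_in_def)
  qed
qed

lemma degree_in_start: "degree_in {{Suc 0, 2}} x = of_bool (x = Suc 0) + of_bool (x = 2)"
proof -
  have "{f. f = {Suc 0, 2} \<and> x \<in> f} = (if x = Suc 0 \<or> x = 2 then {{Suc 0, 2}} else {})" by auto
  then show ?thesis by (auto simp: degree_in_def)
qed

lemma degree_pos_iff: "n \<ge> 1 \<Longrightarrow> e \<in> tree_states n \<Longrightarrow> degree_in e x > 0 \<longleftrightarrow> x \<in> tree_vertices n"
proof (induction rule: tree_states_induct)
  case base
  then show ?case by (auto simp: degree_in_start tree_vertices_def)
next
  case (step n e v)
  then show ?case by (auto simp: degree_in_insert tree_vertices_Suc)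
qed

lemma sum_degree: "n \<ge> 1 \<Longrightarrow> e \<in> tree_states n \<Longrightarrow> sum (degree_in e) (tree_vertices n) = 2 * n"
proof (induction rule: tree_states_induct)
  case base
  have "tree_vertices (Suc 0) = {Suc 0, 2}" by (auto simp: tree_vertices_def)
  then show ?case by (simp add: degree_in_start)
next
  case (step n e v)
  have "degree_in e (Suc (Suc n)) = 0" using degree_pos_iff[OF step(1,2), of "Suc (Suc n)"] by (auto simp: tree_vertices_def)
  moreover have "v \<noteq> Suc (Suc n)" "Suc (Suc n) \<notin> tree_vertices n" using step(3) by (auto simp: tree_vertices_def)
  moreover have "(\<Sum>x\<in>tree_vertices n. of_bool (x = v)) = (1::nat)" using step(3) by simp
  moreover have "(\<Sum>x\<in>tree_vertices n. of_bool (x = Suc (Suc n))) = (0::nat)"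
    by (auto simp: tree_vertices_def)
  ultimately show ?case using step
    by (simp add: tree_vertices_Suc degree_in_insert sum.distrib)
qed

text \<open>Split the endpoints of every edge into the older and the younger one: the older endpoints contribute
  at most \<open>n\<close> in total, the younger ones at most one per vertex.\<close>

lemma sum_degree_le:
  assumes "n \<ge> 1" "e \<in> tree_states n" "finite W"
  shows "sum (degree_in e) W \<le> n + card W"
proof -
  have card_split: "card (W \<inter> (A \<union> B)) = card (W \<inter> A) + card (W \<inter> B)" if "A \<inter> B = {}" for A B
    unfolding Int_Un_distrib using assms(3) that by (intro card_Un_disjoint) auto
  have point: "(\<Sum>x\<in>W. of_bool (x = a)) = card (W \<inter> {a})" for a
    using assms(3) by (simp add: of_bool_def Int_insert_right)
  have "sum (degree_in e) W \<le> n + card (W \<inter> tree_vertices n)"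
    using assms(1,2)
  proof (induction rule: tree_states_induct)
    case base
    have "tree_vertices (Suc 0) = {Suc 0} \<union> {2}" by (auto simp: tree_vertices_def)
    then have "card (W \<inter> tree_vertices (Suc 0)) = card (W \<inter> {Suc 0}) + card (W \<inter> {2})"
      by (simp only:) (rule card_split, simp)
    then show ?case by (simp add: degree_in_start sum.distrib point)
  next
    case (step n e v)
    have "card (W \<inter> {v}) \<le> card {v}" by (intro card_mono) auto
    moreover have "tree_vertices (Suc n) = tree_vertices n \<union> {Suc (Suc n)}"
      by (auto simp: tree_vertices_def)
    then have "card (W \<inter> tree_vertices (Suc n)) = card (W \<inter> tree_vertices n) + card (W \<inter> {Suc (Suc n)})"
      by (simp only:) (rule card_split, simp add: tree_vertices_def)
    ultimately show ?case using step by (simp add: degree_in_insert sum.distrib point)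
  qed
  also have "card (W \<inter> tree_vertices n) \<le> card W" using assms(3) by (intro card_mono) auto
  finally show ?thesis by simp
qed

abbreviation attach_prob :: "nat \<Rightarrow> nat \<Rightarrow> nat set set \<Rightarrow> nat \<Rightarrow> real" where
  "attach_prob d n e \<equiv> choice_prob d (tree_vertices n) (degree_in e)"

lemma sum_attach_prob:
  assumes "n \<ge> 1" "e \<in> tree_states n" "d \<ge> 1"
  shows "(\<Sum>v\<in>tree_vertices n. attach_prob d n e v) = 1"
  using assms sum_degree[OF assms(1,2)] by (intro sum_choice_prob) auto

lemma attach_prob_eq:
  assumes "n \<ge> 1" "e \<in> tree_states n" "d \<ge> 1" "v \<in> tree_vertices n"
  shows "attach_prob d n e v
       = real (degree_in e v) / (2 * real n) * advantage d (tree_vertices n) (degree_in e) (degree_in e v)"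
  using choice_prob_eq[OF finite_tree_vertices assms(3,4)] sum_degree[OF assms(1,2)]
  by (simp del: of_nat_sum)

text \<open>The selection probability per unit of degree is \<open>advantage\<close> up to a
  constant, hence nondecreasing in the degree. In a Polya urn this ratio would be constant; the
  cross-multiplied form is the one in which the drift of \<open>tie_weight\<close> needs it.\<close>

lemma attach_prob_ratio:
  assumes "n \<ge> 1" "e \<in> tree_states n" "d \<ge> 1" "u \<in> tree_vertices n" "v \<in> tree_vertices n"
    and "degree_in e v \<le> degree_in e u"
  shows "attach_prob d n e v * real (degree_in e u) \<le> attach_prob d n e u * real (degree_in e v)"
proof -
  let ?R = "advantage d (tree_vertices n) (degree_in e)"
  let ?c = "real (degree_in e u) * real (degree_in e v) / (2 * real n)"
  have "?c * ?R (degree_in e v) \<le> ?c * ?R (degree_in e u)"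
    using advantage_mono[OF finite_tree_vertices assms(6)] by (intro mult_left_mono) auto
  then show ?thesis by (simp add: attach_prob_eq[OF assms(1-3)] assms(4,5) mult_ac)
qed

text \<open>At most \<open>k\<close> vertices are heavier than \<open>u\<close>, and by
  \<open>sum_degree_le\<close> their degrees sum to at most \<open>n + k\<close>. Out of the total
  \<open>2 * n\<close> at least \<open>n - k \<ge> n / 2\<close> remains, a quarter of the mass, for
  the vertices not heavier than \<open>u\<close>.\<close>

lemma attach_prob_ge:
  assumes n: "n \<ge> 1" and e: "e \<in> tree_states n" and d: "d \<ge> 1" and u: "u \<in> tree_vertices n"
    and k: "card {w \<in> tree_vertices n. degree_in e u < degree_in e w} \<le> k" "2 * k \<le> n"
  shows "attach_prob d n e u \<ge> real (degree_in e u) / (2 * real n) * (1 / 4) ^ (d - 1)"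
proof -
  let ?V = "tree_vertices n" and ?g = "degree_in e"
  let ?H = "{w \<in> ?V. ?g u < ?g w}" and ?L = "{w \<in> ?V. ?g w \<le> ?g u}"
  have "?V = ?L \<union> ?H" by auto
  then have "sum ?g ?V = sum ?g (?L \<union> ?H)" by (rule arg_cong)
  also have "\<dots> = sum ?g ?L + sum ?g ?H" by (rule sum.union_disjoint) auto
  finally have "sum ?g ?V = sum ?g ?L + sum ?g ?H" .
  moreover have "sum ?g ?H \<le> n + k"
    using sum_degree_le[OF n e, of ?H] k(1) by simp
  ultimately have "n \<le> k + sum ?g ?L" using sum_degree[OF n e] by simp
  then have "n \<le> 2 * sum ?g ?L" using k(2) by linarith
  then have "real n \<le> 2 * real (sum ?g ?L)" by (metis of_nat_le_iff of_nat_mult of_nat_numeral)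
  then have "1 / 4 \<le> real (sum ?g ?L) / (2 * real n)" using n by (simp add: field_simps)
  also have "\<dots> = mass ?V ?g (\<lambda>b. b \<le> ?g u)"
    unfolding mass_def sum_degree[OF n e] by (simp add: sum_divide_distrib)
  finally have "1 / 4 \<le> mass ?V ?g (\<lambda>b. b \<le> ?g u)" .
  then have "(1 / 4) ^ (d - 1) \<le> mass ?V ?g (\<lambda>b. b \<le> ?g u) ^ (d - 1)"
    by (intro power_mono) auto
  also have "\<dots> \<le> advantage d ?V ?g (?g u)" by (rule advantage_ge[OF d])
  finally show ?thesis
    unfolding attach_prob_eq[OF n e d u] by (intro mult_left_mono) auto
qed

section \<open>Supermartingales\<close>

text \<open>Up to a factor 4, the density at \<open>1 / 2\<close> of the Beta\<open>(a, b)\<close> distribution, which is the limit law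
  of a Polya urn started from \<open>(a, b)\<close>. It is therefore an exact martingale for the urn, and favouring
  the larger degree only decreases it. The truncated subtractions are harmless since all degrees are
  positive.\<close>

definition tie_weight :: "nat \<Rightarrow> nat \<Rightarrow> real" where
  "tie_weight a b = fact (a + b - 1) / (fact (a - 1) * fact (b - 1)) / 2 ^ (a + b)"

lemma tie_weight_nonneg: "tie_weight a b \<ge> 0"
  by (simp add: tie_weight_def)

lemma tie_weight_commute: "tie_weight a b = tie_weight b a"
  by (simp add: tie_weight_def add.commute mult.commute)

lemma tie_weight_Suc:
  assumes "a \<ge> 1" "b \<ge> 1"
  shows "tie_weight (Suc a) b = tie_weight a b * real (a + b) / (2 * real a)"
proof -
  obtain a' b' where "a = Suc a'" "b = Suc b'" using assms by (metis Suc_le_D One_nat_def)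
  then show ?thesis by (simp add: tie_weight_def field_simps)
qed

lemma tie_weight_one: "m \<ge> 1 \<Longrightarrow> tie_weight m 1 = real m / 2 ^ Suc m"
  by (cases m) (simp_all add: tie_weight_def field_simps)

text \<open>From \<open>(a, a)\<close> to \<open>(a + 1, a + 1)\<close> the weight is multiplied by
  \<open>1 + 1 / (2 * a)\<close>, whose square is at least \<open>(a + 1) / a\<close>. The
  unboundedness of the bound limits the degrees at which ties occur; its least value 1/4 already
  suffices for newly added vertices.\<close>

lemma tie_weight_diagonal: "a \<ge> 1 \<Longrightarrow> sqrt (real a) / 4 \<le> tie_weight a a"
proof (induction a rule: dec_induct)
  case base
  show ?case by (simp add: tie_weight_def)
next
  case (step a)
  have "tie_weight (Suc a) (Suc a) = tie_weight a a * (2 * real a + 1) / (2 * real a)"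
    using step(1) tie_weight_Suc[of a "Suc a"] tie_weight_Suc[of a a] tie_weight_commute[of a "Suc a"]
    by (simp add: field_simps)
  also have "\<dots> = tie_weight a a * (1 + 1 / (2 * real a))" using step(1) by (simp add: field_simps)
  also have "\<dots> \<ge> sqrt (real a) / 4 * sqrt ((real a + 1) / real a)"
  proof (rule mult_mono)
    show "sqrt ((real a + 1) / real a) \<le> 1 + 1 / (2 * real a)"
      using step(1) by (intro real_le_lsqrt) (auto simp: power2_eq_square divide_simps algebra_simps)
  qed (use step tie_weight_nonneg in auto)
  also have "sqrt (real a) / 4 * sqrt ((real a + 1) / real a) = sqrt (real (Suc a)) / 4"
    using step(1) by (simp add: real_sqrt_divide add.commute)
  finally show ?case by simp
qed

text \<open>With selection probabilities p and q of the two vertices, the drift is a nonnegative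
  multiple of (p b - q a)(b - a). The first factor vanishes in a Polya urn; here
  \<open>attach_prob_ratio\<close> makes the two factors have opposite signs.\<close>

lemma tie_weight_supermartingale:
  assumes n: "n \<ge> 1" and e: "e \<in> tree_states n" and d: "d \<ge> 1"
    and u: "u \<in> tree_vertices n" and v: "v \<in> tree_vertices n" and uv: "u \<noteq> v"
  shows "(\<Sum>w\<in>tree_vertices n. attach_prob d n e w *
           tie_weight (degree_in (insert {Suc (Suc n), w} e) u) (degree_in (insert {Suc (Suc n), w} e) v))
       \<le> tie_weight (degree_in e u) (degree_in e v)"
proof -
  let ?V = "tree_vertices n" and ?p = "attach_prob d n e"
  define a b where "a = degree_in e u" and "b = degree_in e v"
  have pos: "a \<ge> 1" "b \<ge> 1"
    using degree_pos_iff[OF n e] u v by (auto simp: a_def b_def Suc_le_eq)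
  have old: "u \<noteq> Suc (Suc n)" "v \<noteq> Suc (Suc n)" using u v by (auto simp: tree_vertices_def)
  define c where "c = tie_weight a b / (2 * real a * real b)"
  have c: "c \<ge> 0" by (auto simp: c_def tie_weight_nonneg)
  have up: "tie_weight (Suc a) b = c * real b * real (a + b)"
    "tie_weight a (Suc b) = c * real a * real (a + b)" "tie_weight a b = c * real a * real b * 2"
    using pos tie_weight_Suc[OF pos] tie_weight_Suc[OF pos(2,1)]
      tie_weight_commute[of a "Suc b"] tie_weight_commute[of a b]
    by (simp_all add: c_def add.commute)
  have key: "(?p u * real b - ?p v * real a) * (real b - real a) \<le> 0"
  proof (cases "b \<le> a")
    case True
    then have "?p v * real a \<le> ?p u * real b"
      using attach_prob_ratio[OF n e d u v] by (simp add: a_def b_def)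
    then show ?thesis using True by (intro mult_nonneg_nonpos) auto
  next
    case False
    then have "?p u * real b \<le> ?p v * real a"
      using attach_prob_ratio[OF n e d v u] by (simp add: a_def b_def)
    then show ?thesis using False by (intro mult_nonpos_nonneg) auto
  qed
  have "(\<Sum>w\<in>?V. ?p w * tie_weight (degree_in (insert {Suc (Suc n), w} e) u) (degree_in (insert {Suc (Suc n), w} e) v))
      = (\<Sum>w\<in>?V. ?p w * tie_weight a b + of_bool (w = u) * (?p w * (tie_weight (Suc a) b - tie_weight a b))
           + of_bool (w = v) * (?p w * (tie_weight a (Suc b) - tie_weight a b)))"
  proof (rule sum.cong[OF refl])
    fix w assume w: "w \<in> ?V"
    show "?p w * tie_weight (degree_in (insert {Suc (Suc n), w} e) u) (degree_in (insert {Suc (Suc n), w} e) v)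
        = ?p w * tie_weight a b + of_bool (w = u) * (?p w * (tie_weight (Suc a) b - tie_weight a b))
           + of_bool (w = v) * (?p w * (tie_weight a (Suc b) - tie_weight a b))"
      using uv old by (auto simp: degree_in_insert[OF n e w] a_def b_def algebra_simps)
  qed
  also have "\<dots> = tie_weight a b + ?p u * (tie_weight (Suc a) b - tie_weight a b)
      + ?p v * (tie_weight a (Suc b) - tie_weight a b)"
  proof -
    have "(\<Sum>w\<in>?V. ?p w * tie_weight a b) = tie_weight a b"
      using sum_attach_prob[OF n e d] by (simp add: sum_distrib_right[symmetric])
    moreover have "(\<Sum>w\<in>?V. of_bool (w = x) * f w) = f x" if "x \<in> ?V" for x and f :: "nat \<Rightarrow> real"
    proof -
      have "(\<Sum>w\<in>?V. of_bool (w = x) * f w) = (\<Sum>w\<in>?V. if w = x then f w else 0)"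
        by (rule sum.cong) auto
      then show ?thesis using that by simp
    qed
    ultimately show ?thesis using u v by (simp add: sum.distrib)
  qed
  also have "\<dots> = tie_weight a b + c * ((?p u * real b - ?p v * real a) * (real b - real a))"
    by (simp add: up algebra_simps)
  also have "\<dots> \<le> tie_weight a b"
    using mult_nonneg_nonpos[OF c key] by simp
  finally show ?thesis by (simp add: a_def b_def)
qed

section \<open>Growth of the top degrees\<close>

definition inverse_degree_sum :: "nat set set \<Rightarrow> nat set \<Rightarrow> real" where
  "inverse_degree_sum e U = (\<Sum>u\<in>U. 1 / real (degree_in e u))"

text \<open>For \<open>k \<le> n + 1\<close> the minimum is attained at \<open>k\<close> vertices of
  highest degree, so this is the sum of the reciprocals of the top \<open>k\<close> degrees. As a
  minimum it is bounded above by any chosen set, with no need to follow how the top set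
  changes.\<close>

definition top_weight :: "nat \<Rightarrow> nat \<Rightarrow> nat set set \<Rightarrow> real" where
  "top_weight k n e = Min (inverse_degree_sum e ` {U. U \<subseteq> tree_vertices n \<and> card U = k})"

lemma finite_subsets_card: "finite {U. U \<subseteq> tree_vertices n \<and> card U = k}"
  by (rule finite_subset[of _ "Pow (tree_vertices n)"]) auto

lemma top_weight_le: "U \<subseteq> tree_vertices n \<Longrightarrow> card U = k \<Longrightarrow> top_weight k n e \<le> inverse_degree_sum e U"
  unfolding top_weight_def using finite_subsets_card by (intro Min_le) auto

lemma top_weight_attained:
  assumes "k \<le> n + 1"
  obtains U where "U \<subseteq> tree_vertices n" "card U = k" "top_weight k n e = inverse_degree_sum e U"
proof -
  have "{U. U \<subseteq> tree_vertices n \<and> card U = k} \<noteq> {}"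
    using obtain_subset_with_card_n[of k "tree_vertices n"] assms by auto
  then have "top_weight k n e \<in> inverse_degree_sum e ` {U. U \<subseteq> tree_vertices n \<and> card U = k}"
    unfolding top_weight_def using finite_subsets_card by (intro Min_in) auto
  then show ?thesis using that by auto
qed

lemma top_weight_nonneg: "k \<le> n + 1 \<Longrightarrow> top_weight k n e \<ge> 0"
  by (rule top_weight_attained[of k n e]) (auto simp: inverse_degree_sum_def intro: sum_nonneg)

text \<open>An exchange argument: trading \<open>u\<close> for a heavier vertex outside
  \<open>U\<close> would lower the sum of reciprocals. Consequently fewer than \<open>k\<close>
  vertices are heavier than a member of \<open>U\<close>, as \<open>attach_prob_ge\<close>
  requires.\<close>

lemma top_weight_set_is_top:
  assumes n: "n \<ge> 1" and e: "e \<in> tree_states n"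
    and U: "U \<subseteq> tree_vertices n" "card U = k" "top_weight k n e = inverse_degree_sum e U"
    and u: "u \<in> U" and w: "w \<in> tree_vertices n" "degree_in e u < degree_in e w"
  shows "w \<in> U"
proof (rule ccontr)
  assume wU: "w \<notin> U"
  have fin: "finite U" by (rule finite_subset[OF U(1)]) simp
  have pos: "degree_in e u > 0" using degree_pos_iff[OF n e] u U(1) by auto
  have "card (insert w (U - {u})) = Suc (card (U - {u}))" using wU fin by (subst card_insert_disjoint) auto
  then have "card (insert w (U - {u})) = k" using card_Suc_Diff1[OF fin u] U(2) by simp
  moreover have "insert w (U - {u}) \<subseteq> tree_vertices n" using U(1) w(1) by auto
  ultimately have "inverse_degree_sum e U \<le> inverse_degree_sum e (insert w (U - {u}))"
    using top_weight_le U(3) by metis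
  also have "\<dots> = inverse_degree_sum e U - 1 / real (degree_in e u) + 1 / real (degree_in e w)"
    using fin u wU by (simp add: inverse_degree_sum_def sum_diff1)
  finally have "1 / real (degree_in e u) \<le> 1 / real (degree_in e w)" by simp
  then show False using w(2) pos by (simp add: field_simps)
qed

text \<open>The minimising set \<open>U\<close> is kept for the next step, which bounds the new
  minimum from above. Selecting a member of degree g lowers its reciprocal by 1 / (g (g + 1)), at
  least 1 / (2 g^2), so \<open>attach_prob_ge\<close> gives each reciprocal an expected relative
  loss of at least \<open>(1 / 4) ^ d / n\<close>.\<close>

lemma top_weight_step:
  assumes n: "n \<ge> 1" and e: "e \<in> tree_states n" and d: "d \<ge> 1" and k: "2 * k \<le> n"
  shows "(\<Sum>w\<in>tree_vertices n. attach_prob d n e w * top_weight k (Suc n) (insert {Suc (Suc n), w} e))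
       \<le> (1 - (1 / 4) ^ d / real n) * top_weight k n e"
proof -
  let ?V = "tree_vertices n" and ?p = "attach_prob d n e" and ?g = "degree_in e"
  let ?c = "(1 / 4 :: real) ^ d / real n"
  obtain U where U: "U \<subseteq> ?V" "card U = k" "top_weight k n e = inverse_degree_sum e U"
    using k top_weight_attained[of k n e] by auto
  have fin: "finite U" by (rule finite_subset[OF U(1)]) simp
  have US: "U \<subseteq> tree_vertices (Suc n)" using U(1) by (auto simp: tree_vertices_def)
  have drop: "?p u * (1 / real (?g u) - 1 / real (Suc (?g u))) \<ge> ?c * (1 / real (?g u))" if u: "u \<in> U" for u
  proof -
    have uV: "u \<in> ?V" using u U by auto
    have g: "?g u \<ge> 1" using degree_pos_iff[OF n e] uV by (simp add: Suc_le_eq)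
    have "card {w \<in> ?V. ?g u < ?g w} \<le> card U"
      using top_weight_set_is_top[OF n e U u] fin by (intro card_mono) auto
    then have p: "?p u \<ge> real (?g u) / (2 * real n) * (1 / 4) ^ (d - 1)"
      using U(2) k by (intro attach_prob_ge[OF n e d uV, of k]) auto
    have "?c * (1 / real (?g u)) = (1 / 4) ^ (d - 1) / (4 * real n * real (?g u))"
      using d by (cases d) (auto simp: field_simps)
    also have "\<dots> \<le> (1 / 4) ^ (d - 1) / (2 * real n * real (Suc (?g u)))"
      using n g by (intro divide_left_mono) auto
    also have "\<dots> = real (?g u) / (2 * real n) * (1 / 4) ^ (d - 1) * (1 / real (?g u) - 1 / real (Suc (?g u)))"
    proof -
      have "1 / real (?g u) - 1 / real (Suc (?g u)) = 1 / (real (?g u) * real (Suc (?g u)))"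
        using g by (simp add: field_simps)
      then show ?thesis using g by (simp only:) simp
    qed
    also have "\<dots> \<le> ?p u * (1 / real (?g u) - 1 / real (Suc (?g u)))"
      using p g by (intro mult_right_mono) (auto simp: field_simps)
    finally show ?thesis .
  qed
  have "(\<Sum>w\<in>?V. ?p w * top_weight k (Suc n) (insert {Suc (Suc n), w} e))
      \<le> (\<Sum>w\<in>?V. ?p w * inverse_degree_sum (insert {Suc (Suc n), w} e) U)"
    by (intro sum_mono mult_left_mono top_weight_le[OF US U(2)] choice_prob_nonneg)
  also have "\<dots> = (\<Sum>w\<in>?V. ?p w * (inverse_degree_sum e U
       - of_bool (w \<in> U) * (1 / real (?g w) - 1 / real (Suc (?g w)))))"
  proof (intro sum.cong refl arg_cong2[where f = "(*)"])
    fix w assume w: "w \<in> ?V"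
    have "inverse_degree_sum (insert {Suc (Suc n), w} e) U
        = (\<Sum>u\<in>U. 1 / real (?g u) - (if u = w then 1 / real (?g w) - 1 / real (Suc (?g w)) else 0))"
      unfolding inverse_degree_sum_def
      using U(1) by (intro sum.cong) (auto simp: degree_in_insert[OF n e w] tree_vertices_def)
    also have "\<dots> = inverse_degree_sum e U - of_bool (w \<in> U) * (1 / real (?g w) - 1 / real (Suc (?g w)))"
      using fin by (simp add: sum_subtractf inverse_degree_sum_def)
    finally show "inverse_degree_sum (insert {Suc (Suc n), w} e) U = \<dots>" .
  qed
  also have "\<dots> = inverse_degree_sum e U
      - (\<Sum>w\<in>?V. of_bool (w \<in> U) * (?p w * (1 / real (?g w) - 1 / real (Suc (?g w)))))"
    using sum_attach_prob[OF n e d]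
    by (simp add: right_diff_distrib sum_subtractf sum_distrib_right[symmetric])
      (simp add: mult_ac)
  also have "(\<Sum>w\<in>?V. of_bool (w \<in> U) * (?p w * (1 / real (?g w) - 1 / real (Suc (?g w)))))
      = (\<Sum>w\<in>U. ?p w * (1 / real (?g w) - 1 / real (Suc (?g w))))"
    using U(1) by (intro sum.mono_neutral_cong_right) auto
  also have "inverse_degree_sum e U - \<dots> \<le> inverse_degree_sum e U - (\<Sum>w\<in>U. ?c * (1 / real (?g w)))"
    by (intro diff_left_mono sum_mono drop)
  also have "\<dots> = (1 - ?c) * top_weight k n e"
    unfolding U(3) inverse_degree_sum_def sum_distrib_left[symmetric] by (simp add: algebra_simps)
  finally show ?thesis .
qed

text \<open>The power of \<open>n\<close> compensates the loss factor of
  \<open>top_weight_step\<close>: 1 - c/n is at most exp (-c/n), while (n + 1)^c is at most n^c exp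
  (c/n).\<close>

lemma top_weight_supermartingale:
  assumes n: "n \<ge> 1" and e: "e \<in> tree_states n" and d: "d \<ge> 1" and k: "2 * k \<le> n"
  shows "(\<Sum>w\<in>tree_vertices n. attach_prob d n e w *
            (real (Suc n) powr ((1 / 4) ^ d) * top_weight k (Suc n) (insert {Suc (Suc n), w} e)))
       \<le> real n powr ((1 / 4) ^ d) * top_weight k n e"
proof -
  define c where "c = (1 / 4 :: real) ^ d"
  have c: "c > 0" by (simp add: c_def)
  have "1 - c / real n \<le> exp (- (c / real n))" using exp_ge_add_one_self[of "- (c / real n)"] by simp
  moreover have "real (Suc n) powr c \<le> real n powr c * exp (c / real n)"
  proof -
    have "ln (real (Suc n)) \<le> ln (real n) + 1 / real n"
    proof -
      have "real (Suc n) = real n * (1 + 1 / real n)" using n by (simp add: field_simps)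
      then have "ln (real (Suc n)) = ln (real n) + ln (1 + 1 / real n)"
        using n by (simp only:) (rule ln_mult_pos, auto intro: add_pos_nonneg)
      then show ?thesis using ln_add_one_self_le_self[of "1 / real n"] by simp
    qed
    then have "c * ln (real (Suc n)) \<le> c * (ln (real n) + 1 / real n)" using c by (intro mult_left_mono) auto
    then show ?thesis using n by (simp add: powr_def exp_add[symmetric] algebra_simps)
  qed
  ultimately have "real (Suc n) powr c * (1 - c / real n)
      \<le> real n powr c * exp (c / real n) * exp (- (c / real n))"
    by (smt (verit) exp_gt_zero mult_left_mono mult_right_mono powr_ge_zero)
  then have *: "real (Suc n) powr c * (1 - c / real n) \<le> real n powr c"
    by (simp add: mult.assoc exp_add[symmetric])
  have "(\<Sum>w\<in>tree_vertices n. attach_prob d n e w *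
            (real (Suc n) powr c * top_weight k (Suc n) (insert {Suc (Suc n), w} e)))
      = real (Suc n) powr c * (\<Sum>w\<in>tree_vertices n. attach_prob d n e w *
            top_weight k (Suc n) (insert {Suc (Suc n), w} e))"
    by (simp add: sum_distrib_left mult.left_commute)
  also have "\<dots> \<le> real (Suc n) powr c * ((1 - c / real n) * top_weight k n e)"
    using top_weight_step[OF assms] by (intro mult_left_mono) (auto simp: c_def)
  also have "\<dots> = real (Suc n) powr c * (1 - c / real n) * top_weight k n e" by simp
  also have "\<dots> \<le> real n powr c * top_weight k n e"
    using * k by (intro mult_right_mono top_weight_nonneg) auto
  finally show ?thesis unfolding c_def .
qed

section \<open>Leading vertices\<close>

text \<open>Only strictly larger degrees are counted, so all vertices tied at rank \<open>k\<close>
  lead and there may be more than \<open>k\<close> of them. Leadership thus depends on the degree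
  alone, and whoever ties with a leading vertex leads too.\<close>

definition leading :: "nat \<Rightarrow> nat \<Rightarrow> nat set set \<Rightarrow> nat \<Rightarrow> bool" where
  "leading k n e i \<longleftrightarrow>
     i \<in> tree_vertices n \<and> card {w \<in> tree_vertices n. degree_in e i < degree_in e w} < k"

definition no_leading_tie :: "nat \<Rightarrow> nat \<Rightarrow> nat set set \<Rightarrow> bool" where
  "no_leading_tie k n e \<longleftrightarrow>
     (\<forall>i \<in> tree_vertices n. \<forall>j \<in> tree_vertices n. i \<noteq> j \<longrightarrow> leading k n e i \<longrightarrow> degree_in e i \<noteq> degree_in e j)"

text \<open>The list packs \<open>K_1, ..., K_k\<close> together with every strict inequality of the
  theorem. What has to be shown is that one fixed list serves from some time on.\<close>

definition top_list :: "nat \<Rightarrow> nat \<Rightarrow> nat set set \<Rightarrow> nat list \<Rightarrow> bool" where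
  "top_list k n e vs \<longleftrightarrow> length vs = k \<and> set vs \<subseteq> tree_vertices n \<and>
     sorted_wrt (\<lambda>a b. degree_in e b < degree_in e a) vs \<and>
     (\<forall>i \<in> tree_vertices n - set vs. \<forall>v \<in> set vs. degree_in e i < degree_in e v)"

text \<open>Pigeonhole: fewer than \<open>k\<close> vertices are heavier than \<open>i\<close>.
  Applied with a set \<open>U\<close> fixed at an earlier time, it says that a vertex which comes to
  lead has caught up with some member of \<open>U\<close>.\<close>

lemma leading_le_top_set:
  assumes i: "leading k n e i" and U: "U \<subseteq> tree_vertices n" "card U = k"
  shows "\<exists>u\<in>U. degree_in e u \<le> degree_in e i"
proof (rule ccontr)
  assume "\<not> ?thesis"
  then have "degree_in e i < degree_in e u" if "u \<in> U" for u using that by force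
  then have "U \<subseteq> {w \<in> tree_vertices n. degree_in e i < degree_in e w}" using U(1) by auto
  then have "card U \<le> card {w \<in> tree_vertices n. degree_in e i < degree_in e w}"
    by (intro card_mono) auto
  then show False using i U by (simp add: leading_def)
qed

lemma top_list_distinct: "top_list k n e vs \<Longrightarrow> distinct vs"
proof -
  have "sorted_wrt (\<lambda>a b. degree_in e b < degree_in e a) vs \<Longrightarrow> distinct vs" by (induction vs) auto
  then show "top_list k n e vs \<Longrightarrow> distinct vs" by (simp add: top_list_def)
qed

text \<open>Greedy choice: a heaviest vertex outside the current list is appended. Only the fewer
  than \<open>k\<close> listed vertices can be heavier, so it leads, and the absence of leading ties
  makes its maximality strict.\<close>

lemma ex_top_list:
  assumes tie: "no_leading_tie k n e"
  shows "m \<le> k \<Longrightarrow> m \<le> n + 1 \<Longrightarrow> \<exists>vs. top_list m n e vs"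
proof (induction m)
  case 0
  then show ?case by (auto simp: top_list_def)
next
  case (Suc m)
  then obtain vs where vs: "top_list m n e vs" by auto
  let ?R = "tree_vertices n - set vs"
  have "card (set vs) = m" using vs top_list_distinct[OF vs] by (simp add: top_list_def distinct_card)
  then have "card ?R \<noteq> 0" using vs Suc(3) by (simp add: top_list_def card_Diff_subset)
  then have ne: "?R \<noteq> {}" by auto
  then have "Max (degree_in e ` ?R) \<in> degree_in e ` ?R" by (intro Max_in) auto
  then obtain x where x: "x \<in> ?R" and "degree_in e x = Max (degree_in e ` ?R)" by (metis imageE)
  then have mx: "degree_in e w \<le> degree_in e x" if "w \<in> ?R" for w using that by simp
  have "{w \<in> tree_vertices n. degree_in e x < degree_in e w} \<subseteq> set vs"
  proof
    fix w assume "w \<in> {w \<in> tree_vertices n. degree_in e x < degree_in e w}"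
    then show "w \<in> set vs" using mx[of w] by (cases "w \<in> set vs") simp_all
  qed
  then have "card {w \<in> tree_vertices n. degree_in e x < degree_in e w} \<le> card (set vs)"
    by (intro card_mono) auto
  then have "leading k n e x"
    using x Suc(2) \<open>card (set vs) = m\<close> by (simp add: leading_def)
  then have "degree_in e w \<noteq> degree_in e x" if "w \<in> ?R" "w \<noteq> x" for w
    using tie x that by (force simp: no_leading_tie_def)
  then have lt: "degree_in e w < degree_in e x" if "w \<in> ?R" "w \<noteq> x" for w
    using mx that by (simp add: order_less_le)
  have "top_list (Suc m) n e (vs @ [x])"
    using vs x lt by (auto simp: top_list_def sorted_wrt_append)
  then show ?case by blast
qed

text \<open>One attachment can turn a strict inequality of degrees into an equality but not reverse
  it, and the added vertex has degree 1. These weak inequalities already show that the listed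
  vertices still lead; the no-tie hypothesis at the new time then applies to them and restores
  strictness.\<close>

lemma top_list_step:
  assumes n: "n \<ge> 1" and e: "e \<in> tree_states n" and v: "v \<in> tree_vertices n"
    and vs: "top_list k n e vs"
    and tie: "no_leading_tie k (Suc n) (insert {Suc (Suc n), v} e)"
  shows "top_list k (Suc n) (insert {Suc (Suc n), v} e) vs"
proof -
  let ?e = "insert {Suc (Suc n), v} e" and ?V = "tree_vertices (Suc n)"
  note deg' = degree_in_insert[OF n e v]
  have pos: "degree_in e a > 0 \<longleftrightarrow> a \<in> tree_vertices n" for a by (rule degree_pos_iff[OF n e])
  have new: "Suc (Suc n) \<notin> tree_vertices n" by (simp add: tree_vertices_def)
  have vsV: "set vs \<subseteq> tree_vertices n" "length vs = k" using vs by (auto simp: top_list_def)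
  have weak: "degree_in ?e b \<le> degree_in ?e a" if "a \<in> set vs" "degree_in e b < degree_in e a" for a b
  proof -
    have "v \<noteq> Suc (Suc n)" using v new by auto
    then have "degree_in ?e b \<le> degree_in e b + 1" by (cases "b = v") (simp_all add: deg')
    moreover have "degree_in e a \<le> degree_in ?e a" by (simp add: deg')
    ultimately show ?thesis using that(2) by linarith
  qed
  have outside: "degree_in ?e b \<le> degree_in ?e a" if a: "a \<in> set vs" and b: "b \<in> ?V - set vs" for a b
  proof (cases "b = Suc (Suc n)")
    case True
    have "b \<noteq> v" "degree_in e b = 0" using True v new pos[of b] by auto
    then have "degree_in ?e b = 1" using True by (simp only: deg') simp
    moreover have "degree_in e a \<ge> 1" using a vsV pos[of a] by auto
    then have "degree_in ?e a \<ge> 1" by (simp add: deg')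
    ultimately show ?thesis by simp
  next
    case False
    then have "b \<in> tree_vertices n - set vs" using b by (auto simp: tree_vertices_Suc)
    then show ?thesis using vs a by (intro weak) (auto simp: top_list_def)
  qed
  have lead: "leading k (Suc n) ?e a" if a: "a \<in> set vs" for a
  proof -
    have "{w \<in> ?V. degree_in ?e a < degree_in ?e w} \<subseteq> set vs - {a}"
    proof
      fix w assume w: "w \<in> {w \<in> ?V. degree_in ?e a < degree_in ?e w}"
      have "w \<in> set vs" using outside[OF a, of w] w by (cases "w \<in> set vs") simp_all
      then show "w \<in> set vs - {a}" using w by auto
    qed
    then have "card {w \<in> ?V. degree_in ?e a < degree_in ?e w} \<le> card (set vs - {a})"
      by (intro card_mono) auto
    also have "\<dots> < card (set vs)" using a by (intro psubset_card_mono) auto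
    also have "\<dots> \<le> k" using vsV card_length[of vs] by simp
    finally show ?thesis using a vsV by (auto simp: leading_def tree_vertices_Suc)
  qed
  have neq: "degree_in ?e a \<noteq> degree_in ?e b" if "a \<in> set vs" "b \<in> ?V" "a \<noteq> b" for a b
  proof -
    have "a \<in> ?V" using that vsV by (auto simp: tree_vertices_Suc)
    then show ?thesis using tie lead[OF that(1)] that unfolding no_leading_tie_def by blast
  qed
  have "sorted_wrt (\<lambda>a b. degree_in ?e b < degree_in ?e a) vs"
  proof (rule sorted_wrt_mono_rel[rotated])
    show "sorted_wrt (\<lambda>a b. degree_in e b < degree_in e a) vs" using vs by (simp add: top_list_def)
    fix a b assume ab: "a \<in> set vs" "b \<in> set vs" "degree_in e b < degree_in e a"
    then have "b \<in> ?V" "a \<noteq> b" using vsV by (auto simp: tree_vertices_Suc)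
    then show "degree_in ?e b < degree_in ?e a" using weak[OF ab(1,3)] neq[OF ab(1)] by (metis order_less_le)
  qed
  moreover have "degree_in ?e b < degree_in ?e a" if "a \<in> set vs" "b \<in> ?V - set vs" for a b
    using outside[OF that] neq[of a b] that by fastforce
  moreover have "set vs \<subseteq> ?V" using vsV by (auto simp: tree_vertices_Suc)
  ultimately show ?thesis unfolding top_list_def using vsV(2) by (intro conjI ballI)
qed

text \<open>The list \<open>?ds\<close> puts the degrees along \<open>vs\<close> before the sorted
  remaining ones. Its reverse is sorted and has the right multiset, so by uniqueness it is the
  sorted degree list.\<close>

lemma top_list_ranked_degree:
  assumes vs: "top_list k n (tree_edges y n) vs" and l: "l \<in> {1..k}"
  shows "ranked_degree y n l = deg y n (vs ! (l - 1))"
proof -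
  let ?g = "deg y n" and ?V = "tree_vertices n"
  let ?ws = "sorted_list_of_set (?V - set vs)"
  let ?ds = "map ?g vs @ rev (sort (map ?g ?ws))"
  have dist: "distinct vs" by (rule top_list_distinct[OF vs])
  have len: "length vs = k" and sub: "set vs \<subseteq> ?V" using vs by (auto simp: top_list_def)
  have mset_list: "mset (sorted_list_of_set A) = mset_set A" for A :: "nat set"
    by (metis mset_sorted_list_of_multiset sorted_list_of_mset_set)
  have "mset vs + mset ?ws = mset_set (set vs) + mset_set (?V - set vs)"
    using dist by (simp add: mset_set_set mset_list)
  also have "\<dots> = mset_set (set vs \<union> (?V - set vs))"
    by (rule mset_set_Union[symmetric]) auto
  also have "set vs \<union> (?V - set vs) = ?V" using sub by auto
  finally have "mset (sorted_list_of_set ?V) = mset vs + mset ?ws"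
    by (simp add: mset_list)
  then have "mset (map ?g (sorted_list_of_set ?V)) = mset (rev ?ds)"
    by (simp only: mset_map mset_append mset_rev mset_sort image_mset_union)
  moreover have "sorted (rev ?ds)"
  proof -
    have "sorted_wrt (\<lambda>a b. ?g b < ?g a) vs" using vs by (simp only: top_list_def)
    then have "sorted_wrt (\<lambda>a b. b \<le> a) (map ?g vs)"
      unfolding sorted_wrt_map by (rule sorted_wrt_mono_rel[rotated]) simp
    then have "sorted (rev (map ?g vs))" by (simp only: sorted_wrt_rev)
    moreover have "x \<le> z" if "x \<in> ?g ` (?V - set vs)" "z \<in> ?g ` set vs" for x z
      using vs that by (auto simp: top_list_def intro: less_imp_le)
    ultimately show ?thesis by (auto simp: sorted_append)
  qed
  ultimately have "sort (map ?g (sorted_list_of_set ?V)) = rev ?ds"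
    by (intro properties_for_sort) auto
  moreover have "k \<le> card ?V"
    using card_mono[OF _ sub] dist len by (simp add: distinct_card)
  ultimately have "ranked_degree y n l = ?ds ! (l - 1)"
    using l by (simp only: ranked_degree_def rev_rev_ident atLeastAtMost_iff) simp
  also have "\<dots> = deg y n (vs ! (l - 1))"
    using l len by (subst nth_append) auto
  finally show ?thesis .
qed

section \<open>Sequences\<close>

lemma power_div_exp2_tendsto_0: "(\<lambda>x. real x ^ p / 2 ^ x) \<longlonglongrightarrow> 0"
proof -
  have "filterlim (\<lambda>x::nat. ln 2 * real x) at_top sequentially"
    by (intro filterlim_tendsto_pos_mult_at_top[OF tendsto_const] filterlim_real_sequentially) simp
  then have "(\<lambda>x::nat. (ln 2 * real x) ^ p / exp (ln 2 * real x)) \<longlonglongrightarrow> 0"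
    by (rule filterlim_compose[OF tendsto_power_div_exp_0])
  then have "(\<lambda>x::nat. inverse (ln 2 ^ p) * ((ln 2 * real x) ^ p / exp (ln 2 * real x))) \<longlonglongrightarrow> inverse (ln 2 ^ p) * 0"
    by (rule tendsto_mult_left)
  moreover have "exp (ln 2 * real x) = 2 ^ x" for x
    by (simp add: mult.commute exp_of_nat_mult)
  ultimately show ?thesis by (simp add: power_mult_distrib field_simps)
qed

text \<open>Trades the exponential bound on a meeting probability for an arbitrary power of a
  reciprocal degree, the quantity that \<open>top_weight\<close> controls. The normalisation
  \<open>C \<ge> 1\<close> later settles the case of weights that are not small.\<close>

lemma power_div_exp2_bounded:
  obtains C :: real where "C \<ge> 1" "\<And>x. x \<ge> 1 \<Longrightarrow> real x / 2 ^ x \<le> C * (1 / real x) ^ q"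
proof -
  have "Bseq (\<lambda>x. real x ^ (q + 1) / 2 ^ x)"
    using convergent_imp_Bseq[OF convergentI[OF power_div_exp2_tendsto_0]] .
  then obtain B where B: "\<And>x. norm (real x ^ (q + 1) / 2 ^ x) \<le> B"
    by (elim BseqE) blast
  show ?thesis
  proof (rule that[of "max B 1"])
    fix x :: nat assume x: "x \<ge> 1"
    have "real x / 2 ^ x = real x ^ (q + 1) / 2 ^ x * (1 / real x) ^ q"
      using x by (simp add: field_simps)
    also have "\<dots> \<le> max B 1 * (1 / real x) ^ q"
      using B[of x] by (intro mult_right_mono) auto
    finally show "real x / 2 ^ x \<le> max B 1 * (1 / real x) ^ q" .
  qed simp
qed

text \<open>A discrete intermediate value argument: \<open>g\<close> rises by at most one per step
  and \<open>f\<close> never falls, so \<open>g\<close> cannot jump over \<open>f\<close>.\<close>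

lemma first_meeting:
  fixes f g :: "nat \<Rightarrow> nat"
  assumes "m \<le> t" "g m \<le> f m" "f t \<le> g t"
    and "\<And>s. s \<ge> m \<Longrightarrow> f s \<le> f (Suc s)" "\<And>s. s \<ge> m \<Longrightarrow> g (Suc s) \<le> g s + 1"
  shows "\<exists>s\<ge>m. f s = g s"
  using assms(1,3)
proof (induction t rule: dec_induct)
  case base
  then show ?case using assms(2) by auto
next
  case (step t)
  show ?case
  proof (cases "f t \<le> g t")
    case True
    then show ?thesis using step by blast
  next
    case False
    then have "g (Suc t) \<le> f (Suc t)" using assms(4,5)[OF step(1)] by linarith
    then show ?thesis using step by (intro exI[of _ "Suc t"]) auto
  qed
qed

section \<open>The random tree\<close>

context max_choice_tree
begin

abbreviation tree_at :: "nat \<Rightarrow> 'a \<Rightarrow> nat set set" where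
  "tree_at n \<omega> \<equiv> tree_edges (\<lambda>i. Y i \<omega>) n"

lemma choices_pos: "d \<ge> 1"
proof -
  obtain \<omega> where "\<omega> \<in> space M" using not_empty by auto
  then have "max_degree_choices d (\<lambda>i. Y i \<omega>) 1 (\<lambda>j. X 1 j \<omega>) \<noteq> {}" using Y_choice[of 1 \<omega>] by auto
  then show ?thesis by (cases d) (auto simp: max_degree_choices_def)
qed

lemma Y_vertex: "n \<ge> 1 \<Longrightarrow> \<omega> \<in> space M \<Longrightarrow> Y n \<omega> \<in> tree_vertices n"
  using Y_choice[of n \<omega>] X_vertex[of n _ \<omega>] by (auto simp: max_degree_choices_def)

lemma tree_at_state: "\<omega> \<in> space M \<Longrightarrow> tree_at n \<omega> \<in> tree_states n"
  unfolding tree_states_def using Y_vertex by auto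

lemma tree_at_measurable: "tree_at n \<in> measurable M (count_space UNIV)"
proof (induction n)
  case (Suc n)
  show ?case
  proof (cases "n = 0")
    case False
    have "(\<lambda>\<omega>. insert {Suc (Suc n), v} (tree_at n \<omega>)) \<in> measurable M (count_space UNIV)" for v
      by (rule measurable_compose[OF Suc]) auto
    moreover have "Y n \<in> measurable M (count_space UNIV)" using False by (intro Y_measurable) auto
    ultimately have "(\<lambda>\<omega>. insert {Suc (Suc n), Y n \<omega>} (tree_at n \<omega>)) \<in> measurable M (count_space UNIV)"
      by (rule measurable_compose_countable)
    then show ?thesis using False by (simp add: tree_edges_Suc)
  qed simp
qed simp

lemma tree_at_sets [measurable]: "{\<omega> \<in> space M. P (tree_at n \<omega>)} \<in> sets M"
proof -
  have "tree_at n -` {e. P e} \<inter> space M \<in> sets M"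
    by (rule measurable_sets[OF tree_at_measurable]) auto
  then show ?thesis by (simp add: vimage_def Int_def conj_commute)
qed

lemma X_sets: "n \<ge> 1 \<Longrightarrow> j \<in> {1..d} \<Longrightarrow> {\<omega> \<in> space M. X n j \<omega> = v} \<in> sets M"
  using measurable_sets[OF X_measurable, of n j "{v}"] by (simp add: vimage_def Int_def conj_commute)

lemma Y_sets: "n \<ge> 1 \<Longrightarrow> {\<omega> \<in> space M. Y n \<omega> = v} \<in> sets M"
  using measurable_sets[OF Y_measurable, of n "{v}"] by (simp add: vimage_def Int_def conj_commute)

section \<open>The two histories as sub-sigma-algebras\<close>

lemma preimages_subset: "Z \<in> measurable M (count_space UNIV) \<Longrightarrow> preimages M Z \<subseteq> sets M"
  by (auto simp: preimages_def intro: measurable_sets)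

lemma edge_history_generators:
  "(\<Union>m \<in> {1..n}. preimages M (tree_at m)) \<subseteq> sets M"
  using preimages_subset[OF tree_at_measurable] by blast

lemma edge_choice_history_generators:
  "n \<ge> 1 \<Longrightarrow> (\<Union>m \<in> {1..n}. preimages M (tree_at m)) \<union> (\<Union>j \<in> {1..d}. preimages M (X n j)) \<subseteq> sets M"
  using preimages_subset[OF tree_at_measurable] preimages_subset[OF X_measurable] by blast

lemma sets_edge_history:
  "sets (edge_history M Y n) = sigma_sets (space M) (\<Union>m \<in> {1..n}. preimages M (tree_at m))"
  unfolding edge_history_def
  using edge_history_generators[of n] sets.space_closed by (intro sets_measure_of) blast

lemma sets_edge_choice_history:
  "n \<ge> 1 \<Longrightarrow> sets (edge_choice_history M d X Y n) = sigma_sets (space M)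
     ((\<Union>m \<in> {1..n}. preimages M (tree_at m)) \<union> (\<Union>j \<in> {1..d}. preimages M (X n j)))"
  unfolding edge_choice_history_def
  using edge_choice_history_generators[of n] sets.space_closed by (intro sets_measure_of) blast

lemma space_edge_history [simp]: "space (edge_history M Y n) = space M"
  unfolding edge_history_def
  using edge_history_generators[of n] sets.space_closed by (intro space_measure_of) blast

lemma space_edge_choice_history [simp]: "n \<ge> 1 \<Longrightarrow> space (edge_choice_history M d X Y n) = space M"
  unfolding edge_choice_history_def
  using edge_choice_history_generators[of n] sets.space_closed by (intro space_measure_of) blast

lemma edge_history_subset: "sets (edge_history M Y n) \<subseteq> sets M"
  unfolding sets_edge_history using edge_history_generators by (rule sets.sigma_sets_subset)

lemma edge_history_mono: "n \<le> m \<Longrightarrow> sets (edge_history M Y n) \<subseteq> sets (edge_history M Y m)"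
  unfolding sets_edge_history by (intro sigma_sets_mono' UN_mono) auto

lemma edge_history_subset_choice:
  "n \<ge> 1 \<Longrightarrow> sets (edge_history M Y n) \<subseteq> sets (edge_choice_history M d X Y n)"
  unfolding sets_edge_history by (simp only: sets_edge_choice_history) (intro sigma_sets_mono' Un_upper1)

lemma sigma_finite_subalgebra_edge_history: "sigma_finite_subalgebra M (edge_history M Y n)"
  by (intro finite_measure_subalgebra_is_sigma_finite finite_measure_subalgebra.intro
      finite_measure_subalgebra_axioms.intro)
    (auto simp: subalgebra_def edge_history_subset finite_measure_axioms)

lemma sigma_finite_subalgebra_edge_choice_history:
  assumes "n \<ge> 1"
  shows "sigma_finite_subalgebra M (edge_choice_history M d X Y n)"
proof -
  have "sets (edge_choice_history M d X Y n) \<subseteq> sets M"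
    unfolding sets_edge_choice_history[OF assms]
    using edge_choice_history_generators[OF assms] by (rule sets.sigma_sets_subset)
  then show ?thesis
    by (intro finite_measure_subalgebra_is_sigma_finite finite_measure_subalgebra.intro
      finite_measure_subalgebra_axioms.intro)
    (use assms in \<open>simp_all add: subalgebra_def finite_measure_axioms\<close>)
qed

lemma tree_at_edge_history:
  assumes "m \<in> {1..n}"
  shows "{\<omega> \<in> space M. P (tree_at m \<omega>)} \<in> sets (edge_history M Y n)"
proof -
  have "{\<omega> \<in> space M. P (tree_at m \<omega>)} \<in> preimages M (tree_at m)"
    unfolding preimages_def by (auto intro!: exI[of _ "{e. P e}"])
  then show ?thesis unfolding sets_edge_history using assms by (intro sigma_sets.Basic) blast
qed

section \<open>The law of one step on events of the history\<close>

lemma samples_law: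
  assumes n: "n \<ge> 1" and e: "e \<in> tree_states n" and x: "x \<in> {1..d} \<rightarrow>\<^sub>E tree_vertices n"
    and B: "B \<in> sets (edge_history M Y n)" "\<And>\<omega>. \<omega> \<in> B \<Longrightarrow> tree_at n \<omega> = e"
  shows "measure M (B \<inter> {\<omega> \<in> space M. \<forall>j\<in>{1..d}. X n j \<omega> = x j})
       = measure M B * (\<Prod>j=1..d. real (degree_in e (x j)) / (2 * real n))"
proof -
  interpret F: sigma_finite_subalgebra M "edge_history M Y n" by (rule sigma_finite_subalgebra_edge_history)
  let ?A = "{\<omega> \<in> space M. \<forall>j\<in>{1..d}. X n j \<omega> = x j}"
  let ?c = "\<Prod>j=1..d. real (degree_in e (x j)) / (2 * real n)"
  have BM: "B \<in> sets M" using B edge_history_subset by auto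
  have A: "?A \<in> sets M"
    using sets.sets_Collect_finite_All[of "{1..d}" M "\<lambda>j \<omega>. X n j \<omega> = x j"] X_sets[OF n] by auto
  have "measure M (B \<inter> ?A) = (\<integral>\<omega>\<in>B. indicator ?A \<omega> \<partial>M)"
    using A BM by (simp add: set_lebesgue_integral_def indicator_inter_arith[symmetric])
  also have "\<dots> = (\<integral>\<omega>\<in>B. real_cond_exp M (edge_history M Y n) (indicator ?A) \<omega> \<partial>M)"
    using A B by (intro F.real_cond_exp_intA integrable_real_indicator) (auto simp: less_top[symmetric])
  \<comment> \<open>On \<open>B\<close> the tree is frozen at \<open>e\<close>, so the random
    conditional probability of \<open>X_law\<close> is a constant there.\<close>
  also have "\<dots> = (\<integral>\<omega>\<in>B. ?c \<partial>M)"
  proof -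
    have "AE \<omega> in M. real_cond_exp M (edge_history M Y n) (indicator ?A) \<omega>
        = (\<Prod>j = 1..d. real (degree_in (tree_at n \<omega>) (x j)) / (2 * real n))"
      by (rule X_law[OF n]) (use x in auto)
    then have "AE \<omega> in M. \<omega> \<in> B \<longrightarrow> real_cond_exp M (edge_history M Y n) (indicator ?A) \<omega> = ?c"
      by eventually_elim (use B(2) in auto)
    then show ?thesis using BM by (intro set_lebesgue_integral_cong_AE) auto
  qed
  also have "\<dots> = measure M B * ?c"
    using BM by (simp add: set_lebesgue_integral_def)
  finally show ?thesis .
qed

text \<open>Two-stage conditioning: \<open>Y_law\<close> turns the event into the tie-breaking
  share, a function of the samples, and averaging this share over the samples by
  \<open>samples_law\<close> produces \<open>choice_prob\<close>.\<close>

lemma choice_law: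
  assumes n: "n \<ge> 1" and e: "e \<in> tree_states n" and v: "v \<in> tree_vertices n"
    and B: "B \<in> sets (edge_history M Y n)" "\<And>\<omega>. \<omega> \<in> B \<Longrightarrow> tree_at n \<omega> = e"
  shows "measure M (B \<inter> {\<omega> \<in> space M. Y n \<omega> = v}) = measure M B * attach_prob d n e v"
proof -
  interpret F: sigma_finite_subalgebra M "edge_choice_history M d X Y n"
    by (rule sigma_finite_subalgebra_edge_choice_history[OF n])
  let ?A = "{\<omega> \<in> space M. Y n \<omega> = v}"
  let ?P = "{1..d} \<rightarrow>\<^sub>E tree_vertices n"
  let ?t = "\<lambda>x. indicator (largest d (degree_in e) x) v / real (card (largest d (degree_in e) x)) :: real"
  let ?E = "\<lambda>x. {\<omega> \<in> space M. \<forall>j\<in>{1..d}. X n j \<omega> = x j}"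
  have BM: "B \<in> sets M" using B edge_history_subset by auto
  have A: "?A \<in> sets M" by (rule Y_sets[OF n])
  have E: "?E x \<in> sets M" for x
    using sets.sets_Collect_finite_All[of "{1..d}" M "\<lambda>j \<omega>. X n j \<omega> = x j"] X_sets[OF n] by auto
  have fin: "finite ?P" by (intro finite_PiE) auto
  \<comment> \<open>The samples form exactly one of finitely many extensional tuples, so the share
    is a simple function. Restriction to \<open>{1..d}\<close> is harmless because
    \<open>largest\<close> looks at no other index.\<close>
  have split: "?t (\<lambda>j. X n j \<omega>) = (\<Sum>x\<in>?P. ?t x * indicator (?E x) \<omega>)" if \<omega>: "\<omega> \<in> space M" for \<omega>
  proof -
    let ?x = "restrict (\<lambda>j. X n j \<omega>) {1..d}"
    have xP: "?x \<in> ?P" using X_vertex[OF n _ \<omega>] by auto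
    have "(\<Sum>x\<in>?P. ?t x * indicator (?E x) \<omega>) = (\<Sum>x\<in>?P. if x = ?x then ?t x else 0)"
    proof (rule sum.cong[OF refl])
      fix x assume x: "x \<in> ?P"
      have "\<omega> \<in> ?E x \<longleftrightarrow> x = ?x"
        using \<omega> x by (auto simp: PiE_def extensional_def fun_eq_iff)
      then show "?t x * indicator (?E x) \<omega> = (if x = ?x then ?t x else 0)" by (auto simp: indicator_def)
    qed
    also have "\<dots> = ?t ?x" using xP fin by simp
    also have "\<dots> = ?t (\<lambda>j. X n j \<omega>)"
      using largest_cong[of d ?x "\<lambda>j. X n j \<omega>" "degree_in e"] by simp
    finally show ?thesis by simp
  qed
  have "measure M (B \<inter> ?A) = (\<integral>\<omega>\<in>B. indicator ?A \<omega> \<partial>M)"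
    using A BM by (simp add: set_lebesgue_integral_def indicator_inter_arith[symmetric])
  also have "\<dots> = (\<integral>\<omega>\<in>B. real_cond_exp M (edge_choice_history M d X Y n) (indicator ?A) \<omega> \<partial>M)"
    using A B edge_history_subset_choice[OF n]
    by (intro F.real_cond_exp_intA integrable_real_indicator) (auto simp: less_top[symmetric])
  also have "\<dots> = (\<integral>\<omega>\<in>B. (\<Sum>x\<in>?P. ?t x * indicator (?E x) \<omega>) \<partial>M)"
  proof -
    have "AE \<omega> in M. real_cond_exp M (edge_choice_history M d X Y n) (indicator ?A) \<omega>
      = (let T = max_degree_choices d (\<lambda>i. Y i \<omega>) n (\<lambda>j. X n j \<omega>) in indicator T v / real (card T))"
      by (rule Y_law[OF n v])
    then have "AE \<omega> in M. \<omega> \<in> B \<longrightarrow> real_cond_exp M (edge_choice_history M d X Y n) (indicator ?A) \<omega>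
      = (\<Sum>x\<in>?P. ?t x * indicator (?E x) \<omega>)"
    proof (eventually_elim, intro impI)
      fix \<omega> assume *: "real_cond_exp M (edge_choice_history M d X Y n) (indicator ?A) \<omega>
        = (let T = max_degree_choices d (\<lambda>i. Y i \<omega>) n (\<lambda>j. X n j \<omega>) in indicator T v / real (card T))"
        and \<omega>: "\<omega> \<in> B"
      have sp: "\<omega> \<in> space M" using \<omega> BM sets.sets_into_space by blast
      have mx: "max_degree_choices d (\<lambda>i. Y i \<omega>) n (\<lambda>j. X n j \<omega>) = largest d (degree_in e) (\<lambda>j. X n j \<omega>)"
        by (simp only: max_degree_choices_def largest_def B(2)[OF \<omega>])
      show "real_cond_exp M (edge_choice_history M d X Y n) (indicator ?A) \<omega>
          = (\<Sum>x\<in>?P. ?t x * indicator (?E x) \<omega>)"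
        unfolding * Let_def mx by (rule split[OF sp])
    qed
    moreover have "(\<lambda>\<omega>. (\<Sum>x\<in>?P. ?t x * indicator (?E x) \<omega>)) \<in> borel_measurable M"
      using E by (intro borel_measurable_sum borel_measurable_times borel_measurable_const borel_measurable_indicator)
    ultimately show ?thesis
      by (intro set_lebesgue_integral_cong_AE BM borel_measurable_cond_exp2)
  qed
  also have "\<dots> = (\<integral>\<omega>. (\<Sum>x\<in>?P. ?t x * indicator (B \<inter> ?E x) \<omega>) \<partial>M)"
    unfolding set_lebesgue_integral_def
    by (intro Bochner_Integration.integral_cong refl)
      (simp only: sum_distrib_left indicator_inter_arith real_scaleR_def mult.left_commute)
  also have "\<dots> = (\<Sum>x\<in>?P. ?t x * measure M (B \<inter> ?E x))"
  proof -
    have BE: "B \<inter> ?E x \<in> sets M" for x using E BM by (rule sets.Int[rotated])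
    then have "integrable M (\<lambda>\<omega>. ?t x * indicator (B \<inter> ?E x) \<omega>)" for x
      by (intro integrable_mult_right integrable_real_indicator) (auto simp: less_top[symmetric])
    then show ?thesis
      using BE by (subst Bochner_Integration.integral_sum) (simp_all only: integral_mult_right_zero integral_indicator,
        simp add: Int_absorb2 sets.sets_into_space)
  qed
  also have "\<dots> = (\<Sum>x\<in>?P. ?t x * (measure M B * (\<Prod>j=1..d. real (degree_in e (x j)) / (2 * real n))))"
    by (intro sum.cong refl arg_cong2[where f = "(*)"] samples_law[OF n e _ B])
  also have "\<dots> = measure M B * attach_prob d n e v"
    unfolding choice_prob_def sum_degree[OF n e] sum_distrib_left
    by (intro sum.cong refl) simp
  finally show ?thesis .
qed

section \<open>Expectations over the finite state space\<close>

lemma integrable_tree_at: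
  assumes n: "n \<ge> 1" and B: "B \<in> sets M"
  shows "integrable M (\<lambda>\<omega>. indicator B \<omega> * f (tree_at n \<omega>) :: real)"
proof (rule Bochner_Integration.integrable_bound)
  let ?K = "\<Sum>e\<in>tree_states n. \<bar>f e\<bar>"
  show "integrable M (\<lambda>_. ?K)" by simp
  have "(\<lambda>\<omega>. f (tree_at n \<omega>)) \<in> borel_measurable M"
    by (rule measurable_compose[OF tree_at_measurable]) auto
  then show "(\<lambda>\<omega>. indicator B \<omega> * f (tree_at n \<omega>)) \<in> borel_measurable M" using B by auto
  have "\<bar>f (tree_at n \<omega>)\<bar> \<le> ?K" if "\<omega> \<in> space M" for \<omega>
    by (rule member_le_sum) (use tree_at_state[OF that] finite_tree_states[OF n] in auto)
  then show "AE \<omega> in M. norm (indicator B \<omega> * f (tree_at n \<omega>)) \<le> norm ?K"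
    by (intro AE_I2) (auto simp: indicator_def abs_mult intro: order_trans sum_nonneg)
qed

lemma integral_sum_indicator:
  fixes c :: "'i \<Rightarrow> real"
  assumes "\<And>i. i \<in> I \<Longrightarrow> A i \<in> sets M"
  shows "(\<integral>\<omega>. (\<Sum>i\<in>I. c i * indicator (A i) \<omega>) \<partial>M) = (\<Sum>i\<in>I. c i * measure M (A i))"
proof -
  have "integrable M (\<lambda>\<omega>. c i * indicator (A i) \<omega>)" if "i \<in> I" for i
    using assms[OF that] by (intro integrable_mult_right integrable_real_indicator) (auto simp: less_top[symmetric])
  moreover have "(\<integral>\<omega>. c i * indicator (A i) \<omega> \<partial>M) = c i * measure M (A i)" if "i \<in> I" for i
    using assms[OF that] by (simp add: Int_absorb2 sets.sets_into_space)
  ultimately show ?thesis by (simp only: Bochner_Integration.integral_sum cong: sum.cong)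
qed

text \<open>The Markov property in integrated form. Splitting \<open>B\<close> by the present state
  and the selected vertex leaves finitely many events, each evaluated by
  \<open>choice_law\<close>.\<close>

lemma integral_tree_at_Suc:
  assumes n: "n \<ge> 1" and B: "B \<in> sets (edge_history M Y n)"
  shows "(\<integral>\<omega>. indicator B \<omega> * f (tree_at (Suc n) \<omega>) \<partial>M)
       = (\<integral>\<omega>. indicator B \<omega> * (\<Sum>v\<in>tree_vertices n.
            attach_prob d n (tree_at n \<omega>) v * f (insert {Suc (Suc n), v} (tree_at n \<omega>))) \<partial>M)"
    (is "?L = ?R")
proof -
  let ?V = "tree_vertices n" and ?S = "tree_states n"
  let ?Be = "\<lambda>e. B \<inter> {\<omega> \<in> space M. tree_at n \<omega> = e}"
  let ?Y = "\<lambda>v. {\<omega> \<in> space M. Y n \<omega> = v}"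
  have BM: "B \<in> sets M" using B edge_history_subset by auto
  have Be: "?Be e \<in> sets (edge_history M Y n)" for e
    using B tree_at_edge_history[of n n "\<lambda>e'. e' = e"] n by (intro sets.Int) auto
  then have BeM: "?Be e \<in> sets M" for e using edge_history_subset by blast
  have BY: "?Be e \<inter> ?Y v \<in> sets M" for e v using BeM[of e] Y_sets[OF n, of v] by (rule sets.Int)
  have fin: "finite ?S" by (rule finite_tree_states[OF n])
  have pick: "(\<Sum>e\<in>?S. if e = a then g e else 0) = (g a :: real)" if "a \<in> ?S" for a g
    using fin that by simp
  have "?L = (\<integral>\<omega>. (\<Sum>e\<in>?S. \<Sum>v\<in>?V. f (insert {Suc (Suc n), v} e) * indicator (?Be e \<inter> ?Y v) \<omega>) \<partial>M)"
  proof (intro Bochner_Integration.integral_cong refl)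
    fix \<omega> assume \<omega>: "\<omega> \<in> space M"
    have "(\<Sum>e\<in>?S. \<Sum>v\<in>?V. f (insert {Suc (Suc n), v} e) * indicator (?Be e \<inter> ?Y v) \<omega>)
        = (\<Sum>e\<in>?S. if e = tree_at n \<omega> then
            (\<Sum>v\<in>?V. if v = Y n \<omega> then indicator B \<omega> * f (insert {Suc (Suc n), v} e) else 0) else 0)"
      using \<omega> by (intro sum.cong refl) (auto simp: indicator_def intro!: sum.cong sum.neutral)
    also have "\<dots> = indicator B \<omega> * f (tree_at (Suc n) \<omega>)"
      using tree_at_state[OF \<omega>] Y_vertex[OF n \<omega>] n by (simp add: pick tree_edges_Suc)
    finally show "indicator B \<omega> * f (tree_at (Suc n) \<omega>)
      = (\<Sum>e\<in>?S. \<Sum>v\<in>?V. f (insert {Suc (Suc n), v} e) * indicator (?Be e \<inter> ?Y v) \<omega>)" by simp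
  qed
  also have "\<dots> = (\<Sum>e\<in>?S. \<Sum>v\<in>?V. f (insert {Suc (Suc n), v} e) * measure M (?Be e \<inter> ?Y v))"
    using integral_sum_indicator[of "?S \<times> ?V" "\<lambda>(e, v). ?Be e \<inter> ?Y v" "\<lambda>(e, v). f (insert {Suc (Suc n), v} e)"] BY
    by (simp only: sum.cartesian_product split_def)
  also have "\<dots> = (\<Sum>e\<in>?S. \<Sum>v\<in>?V. f (insert {Suc (Suc n), v} e) * (measure M (?Be e) * attach_prob d n e v))"
    by (intro sum.cong refl arg_cong2[where f = "(*)"] choice_law[OF n _ _ Be]) auto
  also have "\<dots> = (\<Sum>e\<in>?S. (\<Sum>v\<in>?V. attach_prob d n e v * f (insert {Suc (Suc n), v} e)) * measure M (?Be e))"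
    unfolding sum_distrib_right by (intro sum.cong refl) (simp only: mult_ac)
  also have "\<dots> = (\<integral>\<omega>. (\<Sum>e\<in>?S. (\<Sum>v\<in>?V. attach_prob d n e v * f (insert {Suc (Suc n), v} e)) * indicator (?Be e) \<omega>) \<partial>M)"
    by (rule integral_sum_indicator[symmetric, OF BeM])
  also have "\<dots> = ?R"
  proof (intro Bochner_Integration.integral_cong refl)
    fix \<omega> assume \<omega>: "\<omega> \<in> space M"
    have "(\<Sum>e\<in>?S. (\<Sum>v\<in>?V. attach_prob d n e v * f (insert {Suc (Suc n), v} e)) * indicator (?Be e) \<omega>)
        = (\<Sum>e\<in>?S. if e = tree_at n \<omega> then indicator B \<omega> * (\<Sum>v\<in>?V. attach_prob d n e v * f (insert {Suc (Suc n), v} e)) else 0)"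
      using \<omega> by (intro sum.cong refl) (auto simp: indicator_def)
    also have "\<dots> = indicator B \<omega> * (\<Sum>v\<in>?V. attach_prob d n (tree_at n \<omega>) v * f (insert {Suc (Suc n), v} (tree_at n \<omega>)))"
      by (rule pick[OF tree_at_state[OF \<omega>]])
    finally show "(\<Sum>e\<in>?S. (\<Sum>v\<in>?V. attach_prob d n e v * f (insert {Suc (Suc n), v} e)) * indicator (?Be e) \<omega>)
      = \<dots>" .
  qed
  finally show ?thesis .
qed

text \<open>Doob's maximal inequality, by stopping at the first time the level \<open>l\<close> is
  reached. The restriction to a history event \<open>B\<close> allows the start to be conditioned on
  the tree at time \<open>n0\<close>.\<close>

lemma maximal_inequality:
  fixes W :: "nat \<Rightarrow> nat set set \<Rightarrow> real"
  assumes n0: "n0 \<ge> 1" and B: "B \<in> sets (edge_history M Y n0)" and l: "l > 0"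
    and nonneg: "\<And>n e. n \<ge> n0 \<Longrightarrow> e \<in> tree_states n \<Longrightarrow> W n e \<ge> 0"
    and super: "\<And>n e. n \<ge> n0 \<Longrightarrow> e \<in> tree_states n \<Longrightarrow>
      (\<Sum>v\<in>tree_vertices n. attach_prob d n e v * W (Suc n) (insert {Suc (Suc n), v} e)) \<le> W n e"
  shows "l * measure M {\<omega> \<in> B. \<exists>n\<ge>n0. l \<le> W n (tree_at n \<omega>)}
       \<le> (\<integral>\<omega>. indicator B \<omega> * W n0 (tree_at n0 \<omega>) \<partial>M)"
proof -
  define S where "S n = {\<omega> \<in> B. \<exists>m\<in>{n0..n}. l \<le> W m (tree_at m \<omega>)}" for n
  let ?I = "\<integral>\<omega>. indicator B \<omega> * W n0 (tree_at n0 \<omega>) \<partial>M"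
  have BM: "B \<in> sets M" using B edge_history_subset by auto
  have Bsp: "B \<subseteq> space M" using BM by (rule sets.sets_into_space)
  have SH: "S n \<in> sets (edge_history M Y n)" if "n \<ge> n0" for n
  proof -
    have "S n = B \<inter> (\<Union>m\<in>{n0..n}. {\<omega> \<in> space M. l \<le> W m (tree_at m \<omega>)})"
      using Bsp by (auto simp: S_def)
    moreover have "B \<in> sets (edge_history M Y n)" using B edge_history_mono[OF that] by auto
    moreover have "{\<omega> \<in> space M. l \<le> W m (tree_at m \<omega>)} \<in> sets (edge_history M Y n)" if "m \<in> {n0..n}" for m
      using that n0 by (intro tree_at_edge_history) auto
    ultimately show ?thesis by auto
  qed
  have RH: "B - S n \<in> sets (edge_history M Y n)" if "n \<ge> n0" for n
    using SH[OF that] B edge_history_mono[OF that] by auto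
  have SM: "S n \<in> sets M" "B - S n \<in> sets M" if "n \<ge> n0" for n
    using SH[OF that] RH[OF that] edge_history_subset by auto
  note int = integrable_tree_at
  have intS: "integrable M (\<lambda>\<omega>. l * indicator A \<omega> :: real)" if "A \<in> sets M" for A
    using that by (intro integrable_mult_right integrable_real_indicator) (auto simp: less_top[symmetric])
  have comb: "(\<integral>\<omega>. indicator A \<omega> * f (tree_at n \<omega>) \<partial>M) + l * measure M C
      = (\<integral>\<omega>. indicator A \<omega> * f (tree_at n \<omega>) + l * indicator C \<omega> \<partial>M)"
    if "n \<ge> 1" "A \<in> sets M" "C \<in> sets M" for n A C f
  proof -
    have "(\<integral>\<omega>. l * indicator C \<omega> \<partial>M) = l * measure M C"
      using that by (simp add: Int_absorb2 sets.sets_into_space)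
    then show ?thesis
      using Bochner_Integration.integral_add[OF int[OF that(1,2), of f] intS[OF that(3)]] by (simp only:)
  qed
  \<comment> \<open>The left side bounds from below the expectation of the stopped process: paths in
    \<open>S n\<close> have been stopped and are credited only \<open>l\<close>, the others still
    carry \<open>W\<close>.\<close>
  have bound: "(\<integral>\<omega>. indicator (B - S n) \<omega> * W n (tree_at n \<omega>) \<partial>M) + l * measure M (S n) \<le> ?I" if "n \<ge> n0" for n
    using that
  proof (induction n rule: dec_induct)
    case base
    have "(\<integral>\<omega>. indicator (B - S n0) \<omega> * W n0 (tree_at n0 \<omega>) \<partial>M) + l * measure M (S n0)
        = (\<integral>\<omega>. indicator (B - S n0) \<omega> * W n0 (tree_at n0 \<omega>) + l * indicator (S n0) \<omega> \<partial>M)"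
      by (intro comb n0 SM) auto
    also have "\<dots> \<le> ?I"
    proof (rule integral_mono)
      show "integrable M (\<lambda>\<omega>. indicator (B - S n0) \<omega> * W n0 (tree_at n0 \<omega>) + l * indicator (S n0) \<omega>)"
        by (intro Bochner_Integration.integrable_add int intS SM n0 order_refl)
      show "integrable M (\<lambda>\<omega>. indicator B \<omega> * W n0 (tree_at n0 \<omega>))" by (intro int n0 BM)
    qed (auto simp: S_def indicator_def)
    finally show ?case .
  next
    case (step n)
    have n1: "n \<ge> 1" using step n0 by simp
    have "(\<integral>\<omega>. indicator (B - S (Suc n)) \<omega> * W (Suc n) (tree_at (Suc n) \<omega>) \<partial>M) + l * measure M (S (Suc n))
        = (\<integral>\<omega>. indicator (B - S (Suc n)) \<omega> * W (Suc n) (tree_at (Suc n) \<omega>) \<partial>M)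
          + l * measure M (S (Suc n) - S n) + l * measure M (S n)"
    proof -
      have sub: "S n \<subseteq> S (Suc n)" by (auto simp: S_def)
      have "measure M (S (Suc n) - S n) = measure M (S (Suc n)) - measure M (S n)"
        using step by (intro finite_measure_Diff SM sub) auto
      then have *: "measure M (S (Suc n)) = measure M (S (Suc n) - S n) + measure M (S n)" by simp
      show ?thesis unfolding * by (simp add: distrib_left)
    qed
    also have "(\<integral>\<omega>. indicator (B - S (Suc n)) \<omega> * W (Suc n) (tree_at (Suc n) \<omega>) \<partial>M)
          + l * measure M (S (Suc n) - S n)
        = (\<integral>\<omega>. indicator (B - S (Suc n)) \<omega> * W (Suc n) (tree_at (Suc n) \<omega>) + l * indicator (S (Suc n) - S n) \<omega> \<partial>M)"
      using SM(1)[of n] SM(1)[of "Suc n"] step by (intro comb SM) auto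
    \<comment> \<open>A path stopped exactly at time \<open>Suc n\<close> has
      \<open>W \<ge> l\<close> there, so replacing its value by \<open>l\<close> only loses.\<close>
    also have "\<dots> \<le> (\<integral>\<omega>. indicator (B - S n) \<omega> * W (Suc n) (tree_at (Suc n) \<omega>) \<partial>M)"
    proof (rule integral_mono)
      show "integrable M (\<lambda>\<omega>. indicator (B - S (Suc n)) \<omega> * W (Suc n) (tree_at (Suc n) \<omega>) + l * indicator (S (Suc n) - S n) \<omega>)"
        using SM(1)[of n] SM(1)[of "Suc n"] step
        by (intro Bochner_Integration.integrable_add int intS SM) auto
      show "integrable M (\<lambda>\<omega>. indicator (B - S n) \<omega> * W (Suc n) (tree_at (Suc n) \<omega>))"
        using step by (intro int SM) auto
      fix \<omega> assume \<omega>: "\<omega> \<in> space M"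
      show "indicator (B - S (Suc n)) \<omega> * W (Suc n) (tree_at (Suc n) \<omega>) + l * indicator (S (Suc n) - S n) \<omega>
          \<le> indicator (B - S n) \<omega> * W (Suc n) (tree_at (Suc n) \<omega>)"
        using step(1) by (auto simp: S_def indicator_def le_Suc_eq)
    qed
    also have "\<dots> = (\<integral>\<omega>. indicator (B - S n) \<omega> * (\<Sum>v\<in>tree_vertices n.
            attach_prob d n (tree_at n \<omega>) v * W (Suc n) (insert {Suc (Suc n), v} (tree_at n \<omega>))) \<partial>M)"
      using step by (intro integral_tree_at_Suc[OF n1 RH]) auto
    also have "\<dots> \<le> (\<integral>\<omega>. indicator (B - S n) \<omega> * W n (tree_at n \<omega>) \<partial>M)"
      using step tree_at_state super
      by (intro integral_mono int[OF n1] SM(2) mult_left_mono integrable_tree_at[OF n1, where f = "\<lambda>e. \<Sum>v\<in>tree_vertices n.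
            attach_prob d n e v * W (Suc n) (insert {Suc (Suc n), v} e)"]) auto
    finally show ?case using step by linarith
  qed
  have incS: "incseq (\<lambda>n. S (n0 + n))" by (intro monoI) (fastforce simp: S_def)
  have union: "(\<Union>n. S (n0 + n)) = {\<omega> \<in> B. \<exists>n\<ge>n0. l \<le> W n (tree_at n \<omega>)}"
    unfolding S_def by (auto, metis atLeastAtMost_iff le_add_diff_inverse order_refl)
  have "(\<lambda>n. measure M (S (n0 + n))) \<longlonglongrightarrow> measure M (\<Union>n. S (n0 + n))"
    using SM(1) by (intro finite_Lim_measure_incseq incS) auto
  then have "(\<lambda>n. l * measure M (S (n0 + n))) \<longlonglongrightarrow> l * measure M (\<Union>n. S (n0 + n))"
    by (rule tendsto_mult_left)
  moreover have "l * measure M (S (n0 + n)) \<le> ?I" for n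
  proof -
    have "(\<integral>\<omega>. indicator (B - S (n0 + n)) \<omega> * W (n0 + n) (tree_at (n0 + n) \<omega>) \<partial>M) \<ge> 0"
      by (intro Bochner_Integration.integral_nonneg_AE AE_I2 mult_nonneg_nonneg nonneg tree_at_state) auto
    then show ?thesis using bound[of "n0 + n"] by simp
  qed
  ultimately show ?thesis unfolding union by (intro LIMSEQ_le_const2) auto
qed

section \<open>Degrees of single vertices along a path\<close>

lemma tree_at_Suc: "n \<ge> 1 \<Longrightarrow> tree_at (Suc n) \<omega> = insert {Suc (Suc n), Y n \<omega>} (tree_at n \<omega>)"
  by (simp add: tree_edges_Suc)

lemma degree_tree_at_Suc:
  assumes "n \<ge> 1" "\<omega> \<in> space M"
  shows "degree_in (tree_at (Suc n) \<omega>) x = degree_in (tree_at n \<omega>) x + of_bool (x = Y n \<omega>) + of_bool (x = Suc (Suc n))"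
  using degree_in_insert[OF assms(1) tree_at_state[OF assms(2)] Y_vertex[OF assms]] assms(1)
  by (simp add: tree_at_Suc)

lemma degree_newborn:
  assumes "m \<ge> 2" "\<omega> \<in> space M"
  shows "degree_in (tree_at m \<omega>) (Suc m) = 1"
proof -
  obtain n where n: "m = Suc n" "n \<ge> 1" using assms(1) by (metis Suc_le_D Suc_le_mono numeral_2_eq_2 One_nat_def)
  have "Suc (Suc n) \<notin> tree_vertices n" by (simp add: tree_vertices_def)
  then have "degree_in (tree_at n \<omega>) (Suc (Suc n)) = 0" "Suc (Suc n) \<noteq> Y n \<omega>"
    using degree_pos_iff[OF n(2) tree_at_state[OF assms(2)]] Y_vertex[OF n(2) assms(2)] by auto
  then show ?thesis using degree_tree_at_Suc[OF n(2) assms(2)] n(1) by simp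
qed

text \<open>\<open>Suc m\<close> is the vertex that enters when \<open>P_m\<close> is formed. It
  starts with degree 1, not above \<open>u\<close>, and gains at most one edge per later step, so it
  must meet \<open>u\<close> before overtaking it.\<close>

lemma degree_catches_up:
  assumes \<omega>: "\<omega> \<in> space M" and m: "m \<ge> 2" "m \<le> t" and u: "u \<in> tree_vertices m"
    and le: "degree_in (tree_at t \<omega>) u \<le> degree_in (tree_at t \<omega>) (Suc m)"
  shows "\<exists>s\<ge>m. degree_in (tree_at s \<omega>) u = degree_in (tree_at s \<omega>) (Suc m)"
proof (rule first_meeting[of m t "\<lambda>s. degree_in (tree_at s \<omega>) (Suc m)"])
  have "degree_in (tree_at m \<omega>) u > 0" using degree_pos_iff[OF _ tree_at_state[OF \<omega>]] u m by simp
  then show "degree_in (tree_at m \<omega>) (Suc m) \<le> degree_in (tree_at m \<omega>) u"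
    using degree_newborn[OF m(1) \<omega>] by simp
next
  fix s assume s: "m \<le> s"
  then have s1: "s \<ge> 1" using m by simp
  show "degree_in (tree_at s \<omega>) u \<le> degree_in (tree_at (Suc s) \<omega>) u"
    by (simp only: degree_tree_at_Suc[OF s1 \<omega>])
  have "Suc m \<noteq> Suc (Suc s)" using s by simp
  then show "degree_in (tree_at (Suc s) \<omega>) (Suc m) \<le> degree_in (tree_at s \<omega>) (Suc m) + 1"
    by (simp only: degree_tree_at_Suc[OF s1 \<omega>]) (cases "Suc m = Y s \<omega>"; simp)
qed (use m le in auto)

text \<open>By the maximal inequality the level \<open>L\<close> is ever reached with probability at
  most a constant over \<open>L\<close>, so all levels are reached with probability 0.\<close>

lemma AE_supermartingale_bounded:
  fixes W :: "nat \<Rightarrow> nat set set \<Rightarrow> real"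
  assumes n0: "n0 \<ge> 1"
    and nonneg: "\<And>n e. n \<ge> n0 \<Longrightarrow> e \<in> tree_states n \<Longrightarrow> W n e \<ge> 0"
    and super: "\<And>n e. n \<ge> n0 \<Longrightarrow> e \<in> tree_states n \<Longrightarrow>
      (\<Sum>v\<in>tree_vertices n. attach_prob d n e v * W (Suc n) (insert {Suc (Suc n), v} e)) \<le> W n e"
  shows "AE \<omega> in M. \<exists>L::nat. \<forall>n\<ge>n0. W n (tree_at n \<omega>) < real L"
proof -
  define A where "A L = {\<omega> \<in> space M. \<exists>n\<ge>n0. real L \<le> W n (tree_at n \<omega>)}" for L :: nat
  define I where "I = (\<integral>\<omega>. indicator (space M) \<omega> * W n0 (tree_at n0 \<omega>) \<partial>M)"
  have AM: "A L \<in> sets M" for L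
  proof -
    have "A L = (\<Union>n\<in>{n0..}. {\<omega> \<in> space M. real L \<le> W n (tree_at n \<omega>)})" by (auto simp: A_def)
    then show ?thesis using tree_at_sets by auto
  qed
  have le: "real L * measure M (A L) \<le> I" if "L \<ge> 1" for L
    unfolding A_def I_def
    using that sets.top[of "edge_history M Y n0"]
    by (intro maximal_inequality[where W = W] nonneg super n0) auto
  let ?N = "\<Inter>L. A L"
  have NM: "?N \<in> sets M" using AM by auto
  have bound: "measure M ?N \<le> I / real L" if "L \<ge> 1" for L
  proof -
    have "real L * measure M ?N \<le> real L * measure M (A L)"
      by (intro mult_left_mono finite_measure_mono AM) auto
    then have "real L * measure M ?N \<le> I" using le[OF that] by (rule order_trans)
    then show ?thesis using that by (simp add: pos_le_divide_eq mult.commute)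
  qed
  have "(\<lambda>L. I / real L) \<longlonglongrightarrow> 0" by real_asymp
  then have "measure M ?N \<le> 0"
    by (rule LIMSEQ_le_const) (use bound in auto)
  then have "emeasure M ?N = 0" by (simp add: emeasure_eq_measure measure_le_0_iff)
  then have "AE \<omega> in M. \<omega> \<notin> ?N" using NM by (intro AE_not_in) auto
  then show ?thesis
    using AE_space
  proof eventually_elim
    case (elim \<omega>)
    then obtain L where "\<omega> \<notin> A L" by blast
    then have "\<not> (\<exists>n\<ge>n0. real L \<le> W n (tree_at n \<omega>))" using elim(2) by (simp add: A_def)
    then show ?case using not_le by blast
  qed
qed

section \<open>Almost sure growth, and ties between fixed vertices\<close>

lemma AE_top_weight_decay:
  assumes "n0 \<ge> 1" "n0 \<ge> 2 * k"
  shows "AE \<omega> in M. \<exists>L::nat. \<forall>n\<ge>n0. top_weight k n (tree_at n \<omega>) < real L * real n powr (- ((1 / 4) ^ d))"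
proof -
  let ?c = "(1 / 4 :: real) ^ d"
  have "AE \<omega> in M. \<exists>L::nat. \<forall>n\<ge>n0. real n powr ?c * top_weight k n (tree_at n \<omega>) < real L"
    using assms choices_pos
    by (intro AE_supermartingale_bounded top_weight_supermartingale mult_nonneg_nonneg top_weight_nonneg) auto
  then show ?thesis
  proof (eventually_elim, elim exE)
    fix \<omega> and L :: nat
    assume L: "\<forall>n\<ge>n0. real n powr ?c * top_weight k n (tree_at n \<omega>) < real L"
    have "top_weight k n (tree_at n \<omega>) < real L * real n powr - ?c" if n: "n \<ge> n0" for n
    proof -
      have "real n powr ?c > 0" using n assms by simp
      then show ?thesis using L n by (simp add: powr_minus field_simps)
    qed
    then show "\<exists>L::nat. \<forall>n\<ge>n0. top_weight k n (tree_at n \<omega>) < real L * real n powr - ?c" by blast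
  qed
qed

lemma AE_ties_bounded:
  assumes n0: "n0 \<ge> 1" and ij: "i \<in> tree_vertices n0" "j \<in> tree_vertices n0" "i \<noteq> j"
  shows "AE \<omega> in M. \<exists>s. \<forall>n\<ge>n0. degree_in (tree_at n \<omega>) i = degree_in (tree_at n \<omega>) j
           \<longrightarrow> degree_in (tree_at n \<omega>) i < s"
proof -
  have "AE \<omega> in M. \<exists>L::nat. \<forall>n\<ge>n0.
      tie_weight (degree_in (tree_at n \<omega>) i) (degree_in (tree_at n \<omega>) j) < real L"
  proof (rule AE_supermartingale_bounded[OF n0])
    fix n e assume n: "n \<ge> n0" and e: "e \<in> tree_states n"
    have "i \<in> tree_vertices n" "j \<in> tree_vertices n" "n \<ge> 1"
      using ij n n0 tree_vertices_mono[of n0 n] by auto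
    then show "(\<Sum>v\<in>tree_vertices n. attach_prob d n e v * tie_weight (degree_in (insert {Suc (Suc n), v} e) i)
        (degree_in (insert {Suc (Suc n), v} e) j)) \<le> tie_weight (degree_in e i) (degree_in e j)"
      using ij e choices_pos by (intro tie_weight_supermartingale) auto
  qed (rule tie_weight_nonneg)
  then show ?thesis
    using AE_space
  proof (eventually_elim, elim exE)
    fix \<omega> and L :: nat
    assume \<omega>: "\<omega> \<in> space M" and L: "\<forall>n\<ge>n0. tie_weight (degree_in (tree_at n \<omega>) i) (degree_in (tree_at n \<omega>) j) < real L"
    \<comment> \<open>At a tie of degree a the weight is at least sqrt a / 4; solving sqrt a / 4 < L
      for a gives the square.\<close>
    have "degree_in (tree_at n \<omega>) i < (4 * L)\<^sup>2"
      if n: "n \<ge> n0" and tie: "degree_in (tree_at n \<omega>) i = degree_in (tree_at n \<omega>) j" for n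
    proof -
      let ?a = "degree_in (tree_at n \<omega>) i"
      have "?a \<ge> 1"
        using degree_pos_iff[OF _ tree_at_state[OF \<omega>]] n n0 ij tree_vertices_mono[of n0 n] by (auto simp: Suc_le_eq)
      then have "sqrt (real ?a) / 4 < real L"
        using tie_weight_diagonal[of ?a] L n tie by fastforce
      then have "sqrt (real ?a) < real (4 * L)" by simp
      then have "real ?a < (real (4 * L))\<^sup>2" using real_less_lsqrt real_sqrt_less_iff
        by (metis of_nat_0_le_iff real_sqrt_abs abs_of_nonneg)
      then show ?thesis by (metis of_nat_less_iff of_nat_power)
    qed
    then show "\<exists>s. \<forall>n\<ge>n0. degree_in (tree_at n \<omega>) i = degree_in (tree_at n \<omega>) j
           \<longrightarrow> degree_in (tree_at n \<omega>) i < s" by blast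
  qed
qed

text \<open>On the event that the tree at time \<open>m\<close> is \<open>e\<close>, the tie weight
  starts at g / 2^(g + 1), where g is the degree of \<open>u\<close> in \<open>e\<close>. At any
  meeting it is at least 1/4, and the maximal inequality leaves the factor 4 / 2 = 2.\<close>

lemma newborn_meets:
  assumes m: "m \<ge> 2" and e: "e \<in> tree_states m" and u: "u \<in> tree_vertices m" "u \<noteq> Suc m"
  shows "measure M {\<omega> \<in> space M. tree_at m \<omega> = e \<and>
            (\<exists>s\<ge>m. degree_in (tree_at s \<omega>) u = degree_in (tree_at s \<omega>) (Suc m))}
       \<le> 2 * measure M {\<omega> \<in> space M. tree_at m \<omega> = e} * (real (degree_in e u) / 2 ^ degree_in e u)"
proof -
  let ?B = "{\<omega> \<in> space M. tree_at m \<omega> = e}"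
  let ?W = "\<lambda>(n::nat) e. tie_weight (degree_in e u) (degree_in e (Suc m))"
  have m1: "m \<ge> 1" using m by simp
  have B: "?B \<in> sets (edge_history M Y m)" using m1 by (intro tree_at_edge_history) auto
  then have BM: "?B \<in> sets M" using edge_history_subset by blast
  have v: "Suc m \<in> tree_vertices m" by (simp add: tree_vertices_def)
  have sub: "{\<omega> \<in> space M. tree_at m \<omega> = e \<and>
      (\<exists>s\<ge>m. degree_in (tree_at s \<omega>) u = degree_in (tree_at s \<omega>) (Suc m))}
    \<subseteq> {\<omega> \<in> ?B. \<exists>n\<ge>m. 1 / 4 \<le> ?W n (tree_at n \<omega>)}"
  proof
    fix \<omega> assume "\<omega> \<in> {\<omega> \<in> space M. tree_at m \<omega> = e \<and>
      (\<exists>s\<ge>m. degree_in (tree_at s \<omega>) u = degree_in (tree_at s \<omega>) (Suc m))}"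
    then obtain s where s: "\<omega> \<in> ?B" "s \<ge> m" "degree_in (tree_at s \<omega>) u = degree_in (tree_at s \<omega>) (Suc m)" by auto
    have "degree_in (tree_at s \<omega>) u \<ge> 1"
      using degree_pos_iff[OF _ tree_at_state, of s \<omega> u] s m1 u tree_vertices_mono[of m s] by (auto simp: Suc_le_eq)
    then have "1 / 4 \<le> sqrt (real (degree_in (tree_at s \<omega>) u)) / 4" by simp
    also have "\<dots> \<le> ?W s (tree_at s \<omega>)"
      using tie_weight_diagonal[OF \<open>degree_in (tree_at s \<omega>) u \<ge> 1\<close>] s(3) by simp
    finally show "\<omega> \<in> {\<omega> \<in> ?B. \<exists>n\<ge>m. 1 / 4 \<le> ?W n (tree_at n \<omega>)}" using s by blast
  qed
  have meas: "{\<omega> \<in> ?B. \<exists>n\<ge>m. 1 / 4 \<le> ?W n (tree_at n \<omega>)} \<in> sets M"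
  proof -
    have "{\<omega> \<in> ?B. \<exists>n\<ge>m. 1 / 4 \<le> ?W n (tree_at n \<omega>)}
        = ?B \<inter> (\<Union>n\<in>{m..}. {\<omega> \<in> space M. 1 / 4 \<le> ?W n (tree_at n \<omega>)})" by auto
    also have "\<dots> \<in> sets M" using tree_at_sets by (intro sets.Int BM sets.countable_UN') auto
    finally show ?thesis .
  qed
  have "1 / 4 * measure M {\<omega> \<in> ?B. \<exists>n\<ge>m. 1 / 4 \<le> ?W n (tree_at n \<omega>)}
      \<le> (\<integral>\<omega>. indicator ?B \<omega> * ?W m (tree_at m \<omega>) \<partial>M)"
  proof (rule maximal_inequality[OF m1 B, where W = ?W])
    fix n e assume n: "n \<ge> m" and e: "e \<in> tree_states n"
    have "u \<in> tree_vertices n" "Suc m \<in> tree_vertices n" "n \<ge> 1"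
      using u v n m1 tree_vertices_mono[of m n] by auto
    then show "(\<Sum>v\<in>tree_vertices n. attach_prob d n e v * ?W (Suc n) (insert {Suc (Suc n), v} e)) \<le> ?W n e"
      using u e choices_pos by (intro tie_weight_supermartingale) auto
  qed (auto intro: tie_weight_nonneg)
  also have "(\<integral>\<omega>. indicator ?B \<omega> * ?W m (tree_at m \<omega>) \<partial>M)
      = (\<integral>\<omega>. indicator ?B \<omega> * (real (degree_in e u) / 2 ^ Suc (degree_in e u)) \<partial>M)"
  proof (intro Bochner_Integration.integral_cong refl)
    fix \<omega> assume \<omega>: "\<omega> \<in> space M"
    have "?W m e = real (degree_in e u) / 2 ^ Suc (degree_in e u)" if "tree_at m \<omega> = e"
    proof -
      have "degree_in e (Suc m) = 1" using degree_newborn[OF m \<omega>] that by simp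
      moreover have "degree_in e u \<ge> 1" using degree_pos_iff[OF m1 e] u by (simp add: Suc_le_eq)
      ultimately show ?thesis using tie_weight_one by simp
    qed
    then show "indicator ?B \<omega> * ?W m (tree_at m \<omega>)
        = indicator ?B \<omega> * (real (degree_in e u) / 2 ^ Suc (degree_in e u))"
      by (cases "tree_at m \<omega> = e") auto
  qed
  also have "\<dots> = measure M ?B * (real (degree_in e u) / 2 ^ Suc (degree_in e u))"
    using BM by (simp add: Int_absorb2 sets.sets_into_space)
  finally have "measure M {\<omega> \<in> ?B. \<exists>n\<ge>m. 1 / 4 \<le> ?W n (tree_at n \<omega>)}
      \<le> 2 * measure M ?B * (real (degree_in e u) / 2 ^ degree_in e u)" by (simp add: mult_ac)
  then show ?thesis using finite_measure_mono[OF sub meas] by linarith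
qed

text \<open>To lead at any later time, \<open>Suc m\<close> must meet one of the \<open>k\<close>
  vertices that are on top at time \<open>m\<close>, each of degree at least 1 / \<delta>. A union
  bound over these vertices and over the states at time \<open>m\<close> reduces the claim to
  \<open>newborn_meets\<close>.\<close>

lemma newborn_leading_prob:
  assumes k: "k \<ge> 1"
  shows "\<exists>C. \<forall>m \<delta>. m \<ge> 2 \<longrightarrow> 2 * k \<le> m \<longrightarrow> \<delta> \<ge> 0 \<longrightarrow>
    measure M {\<omega> \<in> space M. top_weight k m (tree_at m \<omega>) \<le> \<delta> \<and> (\<exists>t\<ge>m. leading k t (tree_at t \<omega>) (Suc m))}
    \<le> C * \<delta> ^ q"
proof -
  obtain C :: real where C: "C \<ge> 1" "\<And>x. x \<ge> 1 \<Longrightarrow> real x / 2 ^ x \<le> C * (1 / real x) ^ q"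
    using power_div_exp2_bounded[of q] by blast
  show ?thesis
  proof (intro exI[of _ "2 * real k * C"] allI impI)
    fix m :: nat and \<delta> :: real
    assume m: "m \<ge> 2" "2 * k \<le> m" and \<delta>: "\<delta> \<ge> 0"
    have m1: "m \<ge> 1" using m by simp
    let ?A = "{\<omega> \<in> space M. top_weight k m (tree_at m \<omega>) \<le> \<delta> \<and> (\<exists>t\<ge>m. leading k t (tree_at t \<omega>) (Suc m))}"
    show "measure M ?A \<le> 2 * real k * C * \<delta> ^ q"
    \<comment> \<open>For \<delta> at least 1 the right side is at least 1, by
      \<open>k \<ge> 1\<close> and \<open>C \<ge> 1\<close>. For \<delta> below 1 every top vertex
      has degree above 1.\<close>
    proof (cases "\<delta> < 1")
      case False
      have "1 * 1 \<le> (2 * real k * C) * \<delta> ^ q"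
      proof (rule mult_mono)
        have "1 * 1 \<le> 2 * real k * C" using k C(1) by (intro mult_mono) auto
        then show "1 \<le> 2 * real k * C" by simp
      qed (use False k C in auto)
      then show ?thesis using prob_le_1[of ?A] by linarith
    next
      case True
      define G where "G = {e \<in> tree_states m. top_weight k m e \<le> \<delta>}"
      \<comment> \<open>The reference set is a function of the state at time \<open>m\<close>, so it
        stays fixed while later times are examined.\<close>
      define U where "U e = (SOME U. U \<subseteq> tree_vertices m \<and> card U = k \<and> top_weight k m e = inverse_degree_sum e U)" for e
      have U: "U e \<subseteq> tree_vertices m" "card (U e) = k" "top_weight k m e = inverse_degree_sum e (U e)" for e
      proof -
        have "\<exists>U. U \<subseteq> tree_vertices m \<and> card U = k \<and> top_weight k m e = inverse_degree_sum e U"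
          using top_weight_attained[of k m e] m by auto
        then show "U e \<subseteq> tree_vertices m" "card (U e) = k" "top_weight k m e = inverse_degree_sum e (U e)"
          unfolding U_def by (metis (mono_tags, lifting) someI_ex)+
      qed
      have finU: "finite (U e)" for e by (rule finite_subset[OF U(1)]) simp
      have finG: "finite G" unfolding G_def using finite_tree_states[OF m1] by simp
      have inv_le: "1 / real (degree_in e u) \<le> \<delta>" if "e \<in> G" "u \<in> U e" for e u
      proof -
        have "1 / real (degree_in e u) \<le> inverse_degree_sum e (U e)"
          unfolding inverse_degree_sum_def using that finU by (intro member_le_sum) auto
        then show ?thesis using that U(3)[of e] by (simp add: G_def)
      qed
      define Q where "Q e u = {\<omega> \<in> space M. tree_at m \<omega> = e \<and>
        (\<exists>s\<ge>m. degree_in (tree_at s \<omega>) u = degree_in (tree_at s \<omega>) (Suc m))}" for e u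
      have QM: "Q e u \<in> sets M" for e u
      proof -
        have "Q e u = {\<omega> \<in> space M. tree_at m \<omega> = e} \<inter>
          (\<Union>s\<in>{m..}. {\<omega> \<in> space M. degree_in (tree_at s \<omega>) u = degree_in (tree_at s \<omega>) (Suc m)})"
          by (auto simp: Q_def)
        also have "\<dots> \<in> sets M"
          by (intro sets.Int sets.countable_UN' tree_at_sets) auto
        finally show ?thesis .
      qed
      have cover: "?A \<subseteq> (\<Union>e\<in>G. \<Union>u\<in>U e - {Suc m}. Q e u)"
      proof
        fix \<omega> assume "\<omega> \<in> ?A"
        then obtain t where \<omega>: "\<omega> \<in> space M" and tw: "top_weight k m (tree_at m \<omega>) \<le> \<delta>"
          and t: "t \<ge> m" "leading k t (tree_at t \<omega>) (Suc m)" by auto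
        let ?e = "tree_at m \<omega>"
        have eG: "?e \<in> G" using tw tree_at_state[OF \<omega>] by (simp add: G_def)
        have "U ?e \<subseteq> tree_vertices t" using U(1)[of ?e] tree_vertices_mono[OF t(1)] by blast
        then obtain u where u: "u \<in> U ?e" and le: "degree_in (tree_at t \<omega>) u \<le> degree_in (tree_at t \<omega>) (Suc m)"
          using leading_le_top_set[OF t(2)] U(2) by blast
        \<comment> \<open>The added vertex has degree 1 at time \<open>m\<close>, and a member of
          \<open>U ?e\<close> with degree 1 would force \<delta> to be at least 1.\<close>
        have "u \<noteq> Suc m"
          using inv_le[OF eG u] degree_newborn[OF m(1) \<omega>] True by auto
        moreover have "\<exists>s\<ge>m. degree_in (tree_at s \<omega>) u = degree_in (tree_at s \<omega>) (Suc m)"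
          using degree_catches_up[OF \<omega> m(1) t(1) _ le] u U(1) by blast
        ultimately show "\<omega> \<in> (\<Union>e\<in>G. \<Union>u\<in>U e - {Suc m}. Q e u)"
          using eG u \<omega> by (auto simp: Q_def)
      qed
      have "measure M ?A \<le> measure M (\<Union>e\<in>G. \<Union>u\<in>U e - {Suc m}. Q e u)"
        using finG finU QM by (intro finite_measure_mono cover sets.finite_UN) auto
      also have "\<dots> \<le> (\<Sum>e\<in>G. measure M (\<Union>u\<in>U e - {Suc m}. Q e u))"
        using finG finU QM by (intro finite_measure_subadditive_finite) auto
      also have "\<dots> \<le> (\<Sum>e\<in>G. \<Sum>u\<in>U e - {Suc m}. measure M (Q e u))"
        using finU QM by (intro sum_mono finite_measure_subadditive_finite) auto
      also have "\<dots> \<le> (\<Sum>e\<in>G. \<Sum>u\<in>U e - {Suc m}. measure M {\<omega> \<in> space M. tree_at m \<omega> = e} * (2 * C * \<delta> ^ q))"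
      proof (intro sum_mono)
        fix e u assume e: "e \<in> G" and u: "u \<in> U e - {Suc m}"
        have es: "e \<in> tree_states m" using e by (simp add: G_def)
        have uV: "u \<in> tree_vertices m" using u U(1) by blast
        have pos: "degree_in e u \<ge> 1" using degree_pos_iff[OF m1 es] uV by (simp add: Suc_le_eq)
        let ?p = "measure M {\<omega> \<in> space M. tree_at m \<omega> = e}"
        have "measure M (Q e u) \<le> 2 * ?p * (real (degree_in e u) / 2 ^ degree_in e u)"
          unfolding Q_def using u by (intro newborn_meets m(1) es uV) auto
        also have "\<dots> \<le> 2 * ?p * (C * (1 / real (degree_in e u)) ^ q)"
          by (intro mult_left_mono C(2) pos) auto
        also have "\<dots> \<le> 2 * ?p * (C * \<delta> ^ q)"
          using C(1) inv_le[OF e, of u] u by (intro mult_left_mono power_mono) auto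
        finally show "measure M (Q e u) \<le> ?p * (2 * C * \<delta> ^ q)" by (simp add: mult_ac)
      qed
      also have "\<dots> \<le> (\<Sum>e\<in>G. real k * (measure M {\<omega> \<in> space M. tree_at m \<omega> = e} * (2 * C * \<delta> ^ q)))"
      proof (intro sum_mono)
        fix e
        have "card (U e - {Suc m}) \<le> k" using U(2)[of e] card_mono[OF finU, of "U e - {Suc m}" e] by auto
        then show "(\<Sum>u\<in>U e - {Suc m}. measure M {\<omega> \<in> space M. tree_at m \<omega> = e} * (2 * C * \<delta> ^ q))
            \<le> real k * (measure M {\<omega> \<in> space M. tree_at m \<omega> = e} * (2 * C * \<delta> ^ q))"
          using C \<delta> by (simp only: sum_constant) (intro mult_right_mono, auto)
      qed
      also have "\<dots> = (\<Sum>e\<in>G. measure M {\<omega> \<in> space M. tree_at m \<omega> = e}) * (2 * real k * C * \<delta> ^ q)"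
        unfolding sum_distrib_right by (intro sum.cong refl) (simp only: mult_ac)
      also have "\<dots> \<le> 1 * (2 * real k * C * \<delta> ^ q)"
      proof (rule mult_right_mono)
        have "(\<Sum>e\<in>G. measure M {\<omega> \<in> space M. tree_at m \<omega> = e})
            = measure M (\<Union>e\<in>G. {\<omega> \<in> space M. tree_at m \<omega> = e})"
          using finG by (intro finite_measure_finite_Union[symmetric]) (auto simp: disjoint_family_on_def)
        then show "(\<Sum>e\<in>G. measure M {\<omega> \<in> space M. tree_at m \<omega> = e}) \<le> 1" using prob_le_1 by simp
      qed (use C \<delta> in auto)
      finally show ?thesis by simp
    qed
  qed
qed

lemma AE_newborn_leading:
  fixes L :: nat
  assumes k: "k \<ge> 1"
  shows "AE \<omega> in M. \<forall>\<^sub>F m in sequentially.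
    top_weight k m (tree_at m \<omega>) < real L * real m powr (- ((1 / 4) ^ d)) \<longrightarrow>
    (\<forall>t\<ge>m. \<not> leading k t (tree_at t \<omega>) (Suc m))"
proof -
  define c where "c = (1 / 4 :: real) ^ d"
  have c: "c > 0" by (simp add: c_def)
  \<comment> \<open>With \<open>c * q > 2\<close> the bound on the probability decays at least like
    \<open>m powr - 2\<close>, which is summable.\<close>
  obtain q :: nat where q: "2 / c < real q" using reals_Archimedean2 by blast
  obtain C where C: "\<And>m \<delta>. m \<ge> 2 \<Longrightarrow> 2 * k \<le> m \<Longrightarrow> \<delta> \<ge> 0 \<Longrightarrow>
    measure M {\<omega> \<in> space M. top_weight k m (tree_at m \<omega>) \<le> \<delta> \<and> (\<exists>t\<ge>m. leading k t (tree_at t \<omega>) (Suc m))}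
    \<le> C * \<delta> ^ q" using newborn_leading_prob[OF k, of q] by blast
  define \<delta> where "\<delta> m = real L * real m powr - c" for m
  \<comment> \<open>The guard \<open>2 + 2 * k \<le> m\<close> empties the first events, so one
    bound holds for every \<open>m\<close>.\<close>
  define A where "A m = {\<omega> \<in> space M. 2 + 2 * k \<le> m \<and> top_weight k m (tree_at m \<omega>) \<le> \<delta> m \<and>
      (\<exists>t\<ge>m. leading k t (tree_at t \<omega>) (Suc m))}" for m
  have AM: "A m \<in> sets M" for m
  proof -
    have "A m = {\<omega> \<in> space M. 2 + 2 * k \<le> m \<and> top_weight k m (tree_at m \<omega>) \<le> \<delta> m} \<inter>
        (\<Union>t\<in>{m..}. {\<omega> \<in> space M. leading k t (tree_at t \<omega>) (Suc m)})" by (auto simp: A_def)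
    also have "\<dots> \<in> sets M" by (intro sets.Int sets.countable_UN' tree_at_sets) auto
    finally show ?thesis .
  qed
  have bound: "norm (measure M (A m)) \<le> \<bar>C\<bar> * real L ^ q * real m powr - 2" for m
  proof (cases "2 + 2 * k \<le> m")
    case True
    then have "A m = {\<omega> \<in> space M. top_weight k m (tree_at m \<omega>) \<le> \<delta> m \<and> (\<exists>t\<ge>m. leading k t (tree_at t \<omega>) (Suc m))}"
      by (simp add: A_def)
    then have "measure M (A m) \<le> C * \<delta> m ^ q" using C[of m "\<delta> m"] True by (simp add: \<delta>_def)
    also have "\<dots> \<le> \<bar>C\<bar> * \<delta> m ^ q" by (intro mult_right_mono) (auto simp: \<delta>_def)
    also have "\<delta> m ^ q = real L ^ q * real m powr (- (c * real q))"
      using True by (simp add: \<delta>_def power_mult_distrib powr_power mult.commute)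
    also have "\<bar>C\<bar> * (real L ^ q * real m powr (- (c * real q))) \<le> \<bar>C\<bar> * (real L ^ q * real m powr - 2)"
      using True q c by (intro mult_left_mono powr_mono) (auto simp: field_simps)
    finally show ?thesis by simp
  next
    case False
    then have "A m = {}" by (auto simp: A_def)
    then show ?thesis by simp
  qed
  have "summable (\<lambda>m. \<bar>C\<bar> * real L ^ q * real m powr - 2)"
    by (intro summable_mult) (simp add: summable_real_powr_iff)
  then have "summable (\<lambda>m. measure M (A m))"
    by (rule summable_comparison_test'[where N = 0]) (use bound in auto)
  then have "AE \<omega> in M. \<forall>\<^sub>F m in sequentially. \<omega> \<in> space M - A m"
    by (intro borel_cantelli_AE1 AM) (auto simp: less_top[symmetric])
  then show ?thesis
  proof eventually_elim
    case (elim \<omega>)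
    show ?case using elim eventually_ge_at_top[of "2 + 2 * k"]
      by eventually_elim (auto simp: A_def \<delta>_def c_def)
  qed
qed

lemma AE_no_leading_tie:
  assumes k: "k \<ge> 1"
  shows "AE \<omega> in M. \<forall>\<^sub>F n in sequentially. no_leading_tie k n (tree_at n \<omega>)"
proof -
  let ?c = "(1 / 4 :: real) ^ d"
  \<comment> \<open>The constant of the decay depends on the path. Being a natural number, it allows
    the exceptional null sets to be collected over countably many values.\<close>
  have "AE \<omega> in M. \<forall>L::nat. \<forall>\<^sub>F m in sequentially.
      top_weight k m (tree_at m \<omega>) < real L * real m powr - ?c \<longrightarrow>
      (\<forall>t\<ge>m. \<not> leading k t (tree_at t \<omega>) (Suc m))"
    unfolding AE_all_countable using AE_newborn_leading[OF k] by blast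
  moreover have "AE \<omega> in M. \<exists>L::nat. \<forall>n\<ge>2 * k. top_weight k n (tree_at n \<omega>) < real L * real n powr - ?c"
    using k by (intro AE_top_weight_decay) auto
  moreover have "AE \<omega> in M. \<forall>i j. 1 \<le> i \<longrightarrow> 1 \<le> j \<longrightarrow> i \<noteq> j \<longrightarrow> (\<exists>s. \<forall>n\<ge>max i j.
      degree_in (tree_at n \<omega>) i = degree_in (tree_at n \<omega>) j \<longrightarrow> degree_in (tree_at n \<omega>) i < s)"
    unfolding AE_all_countable
    by (intro allI impI AE_impI AE_ties_bounded) (auto simp: tree_vertices_def)
  ultimately show ?thesis
    using AE_space
  proof eventually_elim
    case (elim \<omega>)
    note ties = elim(3) and \<omega> = elim(4)
    obtain L :: nat where L: "\<And>n. n \<ge> 2 * k \<Longrightarrow> top_weight k n (tree_at n \<omega>) < real L * real n powr - ?c"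
      using elim(2) by blast
    obtain m0 where m0: "\<And>m. m \<ge> m0 \<Longrightarrow> top_weight k m (tree_at m \<omega>) < real L * real m powr - ?c \<longrightarrow>
      (\<forall>t\<ge>m. \<not> leading k t (tree_at t \<omega>) (Suc m))"
      using elim(1) unfolding eventually_sequentially by blast
    \<comment> \<open>A vertex of index above \<open>R\<close> enters at a time
      \<open>m \<ge> R\<close>, when the decay holds and Borel-Cantelli excludes it. Hence only
      indices up to \<open>R\<close> ever lead.\<close>
    define R where "R = max m0 (2 * k)"
    have old: "i \<le> R" if "leading k t (tree_at t \<omega>) i" for t i
    proof (rule ccontr)
      assume "\<not> i \<le> R"
      then obtain m where m: "i = Suc m" "m \<ge> R" by (cases i) auto
      have "m \<le> t" using that m by (auto simp: leading_def tree_vertices_def)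
      then show False using m0[of m] L[of m] m that by (simp add: R_def)
    qed
    have "\<exists>s. \<forall>i\<in>{1..R}. \<forall>j\<in>{1..R}. i \<noteq> j \<longrightarrow> (\<forall>n\<ge>max i j.
      degree_in (tree_at n \<omega>) i = degree_in (tree_at n \<omega>) j \<longrightarrow> degree_in (tree_at n \<omega>) i < s)"
    proof -
      obtain s where s: "\<And>i j n. 1 \<le> i \<Longrightarrow> 1 \<le> j \<Longrightarrow> i \<noteq> j \<Longrightarrow> n \<ge> max i j \<Longrightarrow>
        degree_in (tree_at n \<omega>) i = degree_in (tree_at n \<omega>) j \<Longrightarrow> degree_in (tree_at n \<omega>) i < s i j"
        using ties by metis
      \<comment> \<open>The sum serves as a common upper bound over the finitely many pairs.\<close>
      let ?S = "\<Sum>i\<in>{1..R}. \<Sum>j\<in>{1..R}. s i j"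
      have "s i j \<le> ?S" if "i \<in> {1..R}" "j \<in> {1..R}" for i j
      proof -
        have "s i j \<le> (\<Sum>j\<in>{1..R}. s i j)" by (rule member_le_sum) (use that in auto)
        also have "\<dots> \<le> ?S" by (rule member_le_sum[of i _ "\<lambda>i. \<Sum>j\<in>{1..R}. s i j"]) (use that in auto)
        finally show ?thesis .
      qed
      then show ?thesis using s by (intro exI[of _ ?S]) (fastforce intro: less_le_trans)
    qed
    then obtain s where s: "\<And>i j n. i \<in> {1..R} \<Longrightarrow> j \<in> {1..R} \<Longrightarrow> i \<noteq> j \<Longrightarrow> n \<ge> max i j \<Longrightarrow>
        degree_in (tree_at n \<omega>) i = degree_in (tree_at n \<omega>) j \<Longrightarrow> degree_in (tree_at n \<omega>) i < s"
      by blast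
    \<comment> \<open>Once the top weight is below \<open>1 / Suc s\<close>, all leading degrees
      exceed \<open>s\<close>, the bound for ties among the vertices up to \<open>R\<close>.\<close>
    have "((\<lambda>n. real L * real n powr - ?c) \<longlongrightarrow> real L * 0) sequentially"
      by (intro tendsto_mult_left tendsto_neg_powr filterlim_real_sequentially) simp
    then have "\<forall>\<^sub>F n in sequentially. real L * real n powr - ?c < 1 / real (Suc s)"
      by (rule order_tendstoD) simp
    then show ?case
      using eventually_ge_at_top[of R]
    proof eventually_elim
      case (elim n)
      have nk: "n \<ge> 2 * k" "n \<ge> 1" using elim(2) k by (auto simp: R_def)
      have large: "s < degree_in (tree_at n \<omega>) i" if i: "leading k n (tree_at n \<omega>) i" for i
      proof -
        obtain U where U: "U \<subseteq> tree_vertices n" "card U = k"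
          "top_weight k n (tree_at n \<omega>) = inverse_degree_sum (tree_at n \<omega>) U"
          using top_weight_attained[of k n] nk by auto
        obtain u where u: "u \<in> U" "degree_in (tree_at n \<omega>) u \<le> degree_in (tree_at n \<omega>) i"
          using leading_le_top_set[OF i U(1,2)] by blast
        have pos: "degree_in (tree_at n \<omega>) u > 0"
          using degree_pos_iff[OF nk(2) tree_at_state[OF \<omega>]] u U(1) by auto
        have "1 / real (degree_in (tree_at n \<omega>) i) \<le> 1 / real (degree_in (tree_at n \<omega>) u)"
          using u pos by (intro divide_left_mono) auto
        also have "\<dots> \<le> inverse_degree_sum (tree_at n \<omega>) U"
          unfolding inverse_degree_sum_def using u finite_subset[OF U(1)] by (intro member_le_sum) auto
        also have "\<dots> < 1 / real (Suc s)" using L[OF nk(1)] elim(1) U(3) by linarith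
        finally show ?thesis using u pos by (simp add: field_simps)
      qed
      show ?case unfolding no_leading_tie_def
      proof (intro ballI impI notI)
        fix i j assume ij: "i \<in> tree_vertices n" "j \<in> tree_vertices n" "i \<noteq> j"
          and lead: "leading k n (tree_at n \<omega>) i"
          and eq: "degree_in (tree_at n \<omega>) i = degree_in (tree_at n \<omega>) j"
        have "leading k n (tree_at n \<omega>) j" using lead ij eq by (simp add: leading_def)
        then have "j \<le> R" "i \<le> R" using old lead by auto
        then have "degree_in (tree_at n \<omega>) i < s"
          using ij eq elim(2) by (intro s[of i j]) (auto simp: tree_vertices_def)
        then show False using large[OF lead] by simp
      qed
    qed
  qed
qed

lemma AE_top_list:
  assumes k: "k \<ge> 1"
  shows "AE \<omega> in M. \<exists>n0 vs. n0 \<ge> 1 \<and> (\<forall>n\<ge>n0. top_list k n (tree_at n \<omega>) vs)"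
  using AE_no_leading_tie[OF k] AE_space
proof eventually_elim
  case (elim \<omega>)
  then obtain N where N: "\<And>n. n \<ge> N \<Longrightarrow> no_leading_tie k n (tree_at n \<omega>)"
    unfolding eventually_sequentially by blast
  \<comment> \<open>The second argument of the maximum ensures that the tree has the
    \<open>k\<close> vertices a list requires.\<close>
  define n0 where "n0 = max N k"
  have n0: "n0 \<ge> 1" using k by (simp add: n0_def)
  obtain vs where vs: "top_list k n0 (tree_at n0 \<omega>) vs"
    using ex_top_list[OF N[of n0] order_refl] by (force simp: n0_def)
  have "top_list k n (tree_at n \<omega>) vs" if "n \<ge> n0" for n
    using that
  proof (induction n rule: dec_induct)
    case (step n)
    then have n1: "n \<ge> 1" "n \<ge> N" using n0 by (auto simp: n0_def)
    show ?case
      using top_list_step[OF n1(1) tree_at_state[OF elim(2)] Y_vertex[OF n1(1) elim(2)] step(3)]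
        N[of "Suc n"] n1 by (simp add: tree_at_Suc)
  qed (rule vs)
  then show ?case using n0 by blast
qed

end

theorem proposition1p2:
  fixes M :: "'a measure"
    and d k :: nat
    and X :: "nat \<Rightarrow> nat \<Rightarrow> 'a \<Rightarrow> nat"
    and Y :: "nat \<Rightarrow> 'a \<Rightarrow> nat"
  assumes "max_choice_tree M d X Y"
    and "d \<ge> 2"
    and "k \<ge> 1"
  shows "\<exists>(N :: nat \<Rightarrow> 'a \<Rightarrow> enat) (K :: nat \<Rightarrow> 'a \<Rightarrow> nat).
    \<forall>l \<in> {1..k}.
      N l \<in> measurable M (count_space UNIV) \<and>
      K l \<in> measurable M (count_space UNIV) \<and>
      (AE \<omega> in M. N l \<omega> < \<infinity>) \<and>
      (\<forall>\<omega> \<in> space M. K l \<omega> \<ge> 1) \<and>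
      (\<forall>\<omega> \<in> space M. \<forall>n \<ge> 1. N l \<omega> \<le> enat n \<longrightarrow>
        deg (\<lambda>i. Y i \<omega>) n (K l \<omega>) = ranked_degree (\<lambda>i. Y i \<omega>) n l \<and>
        (\<forall>j \<in> {1..<l}. ranked_degree (\<lambda>i. Y i \<omega>) n j > ranked_degree (\<lambda>i. Y i \<omega>) n (j + 1)) \<and>
        (\<forall>i \<in> tree_vertices n. i \<notin> (\<lambda>j. K j \<omega>) ` {1..l} \<longrightarrow>
           ranked_degree (\<lambda>i. Y i \<omega>) n l > deg (\<lambda>i. Y i \<omega>) n i))"
proof -
  interpret max_choice_tree M d X Y by fact
  note k = \<open>k \<ge> 1\<close>
  \<comment> \<open>A witness pairs a starting time with a list that is valid from then on. There
    are countably many such pairs, which makes a measurable choice possible.\<close>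
  define good where "good p \<omega> \<longleftrightarrow> fst p \<ge> 1 \<and> (\<forall>n\<ge>fst p. top_list k n (tree_at n \<omega>) (snd p))"
    for p :: "nat \<times> nat list" and \<omega>
  \<comment> \<open>Choosing the least code of a valid pair makes the selection measurable, since
    each \<open>good p\<close> is a measurable event.\<close>
  define code where "code \<omega> = (if \<exists>c. good (from_nat c) \<omega> then Some (LEAST c. good (from_nat c) \<omega>) else None)" for \<omega>
  \<comment> \<open>One time serves for all \<open>l\<close>. On the exceptional null set
    \<open>N\<close> is infinite, so nothing is claimed there, and \<open>K\<close> takes the value
    1 to remain a vertex index.\<close>
  define N where "N = (\<lambda>(l::nat) \<omega>. case code \<omega> of None \<Rightarrow> \<infinity> | Some c \<Rightarrow> enat (fst (from_nat c :: nat \<times> nat list)))"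
  define K where "K = (\<lambda>l \<omega>. case code \<omega> of None \<Rightarrow> 1 | Some c \<Rightarrow> snd (from_nat c :: nat \<times> nat list) ! (l - 1))"
  have good_sets: "{\<omega> \<in> space M. good p \<omega>} \<in> sets M" for p
  proof -
    have "{\<omega> \<in> space M. good p \<omega>}
        = {\<omega> \<in> space M. fst p \<ge> 1} \<inter> {\<omega> \<in> space M. \<forall>n. fst p \<le> n \<longrightarrow> top_list k n (tree_at n \<omega>) (snd p)}"
      unfolding good_def by blast
    also have "\<dots> \<in> sets M"
      by (intro sets.Int sets.sets_Collect_countable_All tree_at_sets)
    finally show ?thesis .
  qed
  then have [measurable]: "Measurable.pred M (good p)" for p by (simp add: pred_def)
  have code: "code \<in> measurable M (count_space UNIV)"
    unfolding code_def by measurable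
  have N: "N l \<in> measurable M (count_space UNIV)" for l
    unfolding N_def by (rule measurable_compose[OF code]) simp
  have K: "K l \<in> measurable M (count_space UNIV)" for l
    unfolding K_def by (rule measurable_compose[OF code]) simp
  have code_Some: "good (from_nat c) \<omega>" if "code \<omega> = Some c" for c \<omega>
    using that unfolding code_def by (metis LeastI_ex option.distinct(1) option.inject)
  have fin: "AE \<omega> in M. N l \<omega> < \<infinity>" for l
    using AE_top_list[OF k]
  proof eventually_elim
    case (elim \<omega>)
    then obtain n0 vs where "good (n0, vs) \<omega>" by (auto simp: good_def)
    then have "good (from_nat (to_nat (n0, vs))) \<omega>" by simp
    then have "\<exists>c. good (from_nat c) \<omega>" by blast
    then show ?case by (simp add: N_def code_def)
  qed
  have pos: "K l \<omega> \<ge> 1" if "l \<in> {1..k}" for l \<omega>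
  proof (cases "code \<omega>")
    case (Some c)
    let ?vs = "snd (from_nat c :: nat \<times> nat list)" and ?n = "fst (from_nat c :: nat \<times> nat list)"
    have "top_list k ?n (tree_at ?n \<omega>) ?vs" using code_Some[OF Some] by (simp add: good_def)
    then have "?vs ! (l - 1) \<in> tree_vertices ?n" using that by (auto simp: top_list_def intro!: subsetD[OF _ nth_mem])
    then show ?thesis by (simp add: K_def Some tree_vertices_def)
  qed (simp add: K_def)
  have main: "deg (\<lambda>i. Y i \<omega>) n (K l \<omega>) = ranked_degree (\<lambda>i. Y i \<omega>) n l \<and>
        (\<forall>j \<in> {1..<l}. ranked_degree (\<lambda>i. Y i \<omega>) n j > ranked_degree (\<lambda>i. Y i \<omega>) n (j + 1)) \<and>
        (\<forall>i \<in> tree_vertices n. i \<notin> (\<lambda>j. K j \<omega>) ` {1..l} \<longrightarrow>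
           ranked_degree (\<lambda>i. Y i \<omega>) n l > deg (\<lambda>i. Y i \<omega>) n i)"
    if l: "l \<in> {1..k}" and n: "N l \<omega> \<le> enat n" for l n \<omega>
  proof -
    obtain c where c: "code \<omega> = Some c" using n by (cases "code \<omega>") (auto simp: N_def)
    let ?vs = "snd (from_nat c :: nat \<times> nat list)"
    let ?g = "deg (\<lambda>i. Y i \<omega>) n"
    have "fst (from_nat c :: nat \<times> nat list) \<le> n" using n c by (simp add: N_def)
    then have top: "top_list k n (tree_at n \<omega>) ?vs" using code_Some[OF c] by (simp add: good_def)
    have Kj: "K j \<omega> = ?vs ! (j - 1)" for j by (simp add: K_def c)
    have rank: "ranked_degree (\<lambda>i. Y i \<omega>) n j = ?g (?vs ! (j - 1))" if "j \<in> {1..k}" for j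
      by (rule top_list_ranked_degree[OF top that])
    have len: "length ?vs = k" and sorted: "sorted_wrt (\<lambda>a b. ?g b < ?g a) ?vs"
      using top by (auto simp: top_list_def)
    have dec: "?g (?vs ! b) < ?g (?vs ! a)" if "a < b" "b < k" for a b
      using sorted_wrt_nth_less[OF sorted that(1)] that(2) len by simp
    have "?g i < ?g (?vs ! (l - 1))" if i: "i \<in> tree_vertices n" "i \<notin> (\<lambda>j. K j \<omega>) ` {1..l}" for i
    proof (cases "i \<in> set ?vs")
      case True
      then obtain a where a: "a < k" "i = ?vs ! a" using len by (metis in_set_conv_nth)
      have "\<not> a < l"
      proof
        assume "a < l"
        then have "i = K (Suc a) \<omega>" "Suc a \<in> {1..l}" using a by (auto simp: Kj)
        then show False using i(2) by blast
      qed
      then show ?thesis using dec[of "l - 1" a] a l by auto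
    next
      case False
      then show ?thesis using top i l len by (auto simp: top_list_def)
    qed
    moreover have "?g (?vs ! (j + 1 - 1)) < ?g (?vs ! (j - 1))" if "j \<in> {1..<l}" for j
      using that l by (intro dec) auto
    ultimately show ?thesis using l by (auto simp: rank Kj)
  qed
  show ?thesis
    by (rule exI[of _ N], rule exI[of _ K]) (use N K fin pos main in blast)
qed

end
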